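(* Let $d$ be a non-negative integer and let $\varepsilon:\mathfrak{S}_d\to\{\pm1\}$ be the sign morphism. For every partition $\mu$ of $d$, the signed Frobenius-Schur indicator satisfies $$SFS_{\mathfrak{S}_d,\varepsilon}(\mu) = \begin{cases} (-1)^{\frac{d-r(\mu)}{2}} & \text{if } \mu^T=\mu,\\ 0 & \text{otherwise.}\end{cases}$$
   Context: For a partition $\mu$ of $d$, $\rho_\mu$ is the irreducible complex representation of the symmetric group $\mathfrak{S}_d$ labelled by $\mu$ in the standard way and $\chi_\mu$ is its character. The signed Frobenius-Schur indicator is $SFS_{\mathfrak{S}_d,\varepsilon}(\mu)=\frac{1}{d!}\sum_{\tau\in\mathfrak{S}_d}\varepsilon(\tau)\chi_\mu(\tau^2)$. The partition $\mu^T$ is the one whose Young diagram is the transpose of that of $\mu$, and $r(\mu)=\#\{i\mid \mu_i\ge i\}$ is the number of boxes on the diagonal of the Young diagram of $\mu$. *)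

theory Defs
  imports
    Complex_Main
    "HOL-Algebra.Sym_Groups"
    "HOL-Library.Function_Algebras"
begin

section \<open>Partitions and Young diagrams\<close>

definition is_partition :: "nat \<Rightarrow> nat list \<Rightarrow> bool" where
  "is_partition d \<mu> \<longleftrightarrow> sorted_wrt (\<ge>) \<mu> \<and> 0 \<notin> set \<mu> \<and> sum_list \<mu> = d"

text \<open>Rows and columns are numbered from 0.\<close>

definition young_diagram :: "nat list \<Rightarrow> (nat \<times> nat) set" where
  "young_diagram \<mu> = {(i, j). i < length \<mu> \<and> j < \<mu> ! i}"

definition conj_partition :: "nat list \<Rightarrow> nat list" where
  "conj_partition \<mu> =
     map (\<lambda>j. card {i. i < length \<mu> \<and> j < \<mu> ! i}) [0..<(if \<mu> = [] then 0 else hd \<mu>)]"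

text \<open>\<open>r(\<mu>) = #{i | \<mu>\<^sub>i \<ge> i}\<close>; the shift comes from numbering the parts from 0.\<close>

definition diag_length :: "nat list \<Rightarrow> nat" where
  "diag_length \<mu> = card {i. i < length \<mu> \<and> \<mu> ! i \<ge> Suc i}"

lemma partition_antimono:
  assumes "is_partition d \<mu>" "i \<le> k" "k < length \<mu>"
  shows "\<mu> ! k \<le> \<mu> ! i"
  using assms sorted_wrt_nth_less[of "(\<ge>)" \<mu> i k]
  by (cases "i = k") (auto simp: is_partition_def)

lemma young_diagram_conj:
  assumes "is_partition d \<mu>"
  shows "young_diagram (conj_partition \<mu>) = prod.swap ` young_diagram \<mu>"
proof -
  have iff: "i < card {i. i < length \<mu> \<and> j < \<mu> ! i} \<longleftrightarrow> i < length \<mu> \<and> j < \<mu> ! i" for i j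
  proof -
    let ?S = "{i. i < length \<mu> \<and> j < \<mu> ! i}"
    have fin: "finite ?S" by simp
    have down: "k \<in> ?S" if "l \<in> ?S" "k \<le> l" for k l
      using that partition_antimono[OF assms, of k l] by auto
    show ?thesis
    proof
      assume "i < card ?S"
      have "\<exists>l\<in>?S. i \<le> l"
      proof (rule ccontr)
        assume "\<not> (\<exists>l\<in>?S. i \<le> l)"
        then have "?S \<subseteq> {..<i}" by auto
        then have "card ?S \<le> i" using card_mono[of "{..<i}" ?S] by simp
        with \<open>i < card ?S\<close> show False by simp
      qed
      then show "i < length \<mu> \<and> j < \<mu> ! i" using down by blast
    next
      assume "i < length \<mu> \<and> j < \<mu> ! i"
      then have "{..i} \<subseteq> ?S" using down by blast
      then have "card {..i} \<le> card ?S" using fin card_mono by blast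
      then show "i < card ?S" by simp
    qed
  qed
  have width: "\<mu> \<noteq> [] \<and> j < hd \<mu>" if "i < length \<mu>" "j < \<mu> ! i" for i j
    using that partition_antimono[OF assms, of 0 i] hd_conv_nth[of \<mu>]
    by (cases "\<mu> = []") auto
  have "(j, i) \<in> young_diagram (conj_partition \<mu>) \<longleftrightarrow> (i, j) \<in> young_diagram \<mu>" for i j
    using width[of i j] iff[of i j]
    by (cases "\<mu> = []"; cases "j < hd \<mu>") (auto simp: young_diagram_def conj_partition_def)
  then show ?thesis
    by auto
qed

lemma card_young_diagram: "card (young_diagram \<mu>) = sum_list \<mu>"
proof -
  have "young_diagram \<mu> = (SIGMA i:{..<length \<mu>}. {..<\<mu> ! i})"
    by (auto simp: young_diagram_def)
  then show ?thesis by (simp add: sum_list_sum_nth atLeast0LessThan)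
qed

lemma is_partition_conj:
  assumes "is_partition d \<mu>"
  shows "is_partition d (conj_partition \<mu>)"
proof -
  have "sorted_wrt (\<ge>) (conj_partition \<mu>)"
    unfolding sorted_wrt_iff_nth_less conj_partition_def
    by (auto intro!: card_mono)
  moreover have "0 \<notin> set (conj_partition \<mu>)"
    by (auto simp: conj_partition_def hd_conv_nth split: if_splits)
  moreover have "sum_list (conj_partition \<mu>) = d"
    using assms young_diagram_conj[OF assms] card_image[of prod.swap "young_diagram \<mu>"]
      card_young_diagram[of \<mu>] card_young_diagram[of "conj_partition \<mu>"]
    by (simp add: is_partition_def)
  ultimately show ?thesis by (simp add: is_partition_def)
qed


section \<open>Group algebras and traces\<close>

text \<open>Elements of \<open>\<complex>[G]\<close> are the functions on the underlying type that vanish outside the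
  carrier of \<open>G\<close>.\<close>

definition group_algebra :: "('a, 'm) monoid_scheme \<Rightarrow> ('a \<Rightarrow> complex) set" where
  "group_algebra G = {x. \<forall>g. g \<notin> carrier G \<longrightarrow> x g = 0}"

definition ga_basis :: "'a \<Rightarrow> 'a \<Rightarrow> complex" where
  "ga_basis g = (\<lambda>h. if h = g then 1 else 0)"

definition ga_mult ::
  "('a, 'm) monoid_scheme \<Rightarrow> ('a \<Rightarrow> complex) \<Rightarrow> ('a \<Rightarrow> complex) \<Rightarrow> ('a \<Rightarrow> complex)" where
  "ga_mult G x y = (\<lambda>g. if g \<in> carrier G
     then \<Sum>h\<in>carrier G. x h * y (inv\<^bsub>G\<^esub> h \<otimes>\<^bsub>G\<^esub> g) else 0)"

definition cfun_scale :: "complex \<Rightarrow> ('a \<Rightarrow> complex) \<Rightarrow> ('a \<Rightarrow> complex)" where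
  "cfun_scale c x = (\<lambda>g. c * x g)"

global_interpretation cfun: vector_space cfun_scale
  by unfold_locales (auto simp: cfun_scale_def fun_eq_iff algebra_simps)

text \<open>The trace of a linear endomorphism of a finite-dimensional subspace \<open>V\<close>, computed in some
  basis of \<open>V\<close>.\<close>

definition (in vector_space) trace_on :: "'b set \<Rightarrow> ('b \<Rightarrow> 'b) \<Rightarrow> 'a" where
  "trace_on V f =
     (let B = (SOME B. independent B \<and> span B = V) in \<Sum>b\<in>B. representation B (f b) b)"


section \<open>The irreducible representations of the symmetric group\<close>

text \<open>The representation labelled by \<open>\<mu>\<close> is the left ideal of \<open>\<complex>[\<SS>\<^sub>d]\<close> generated by the Young
  symmetrizer of a tableau of shape \<open>\<mu>\<close>, with \<open>\<SS>\<^sub>d\<close> acting by left multiplication. The one-row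
  partition \<open>(d)\<close> labels the trivial representation and \<open>(1, \<dots>, 1)\<close> the sign. The tableau used
  is the one filled row by row with \<open>1, \<dots>, d\<close>.\<close>

definition row_tableau :: "nat list \<Rightarrow> nat \<times> nat \<Rightarrow> nat" where
  "row_tableau \<mu> = (\<lambda>(i, j). sum_list (take i \<mu>) + j + 1)"

definition row_group :: "nat \<Rightarrow> nat list \<Rightarrow> (nat \<Rightarrow> nat) set" where
  "row_group d \<mu> = {p \<in> carrier (sym_group d).
     \<forall>(i, j)\<in>young_diagram \<mu>. \<exists>j'. (i, j') \<in> young_diagram \<mu> \<and>
       p (row_tableau \<mu> (i, j)) = row_tableau \<mu> (i, j')}"

definition column_group :: "nat \<Rightarrow> nat list \<Rightarrow> (nat \<Rightarrow> nat) set" where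
  "column_group d \<mu> = {p \<in> carrier (sym_group d).
     \<forall>(i, j)\<in>young_diagram \<mu>. \<exists>i'. (i', j) \<in> young_diagram \<mu> \<and>
       p (row_tableau \<mu> (i, j)) = row_tableau \<mu> (i', j)}"

definition row_symmetrizer :: "nat \<Rightarrow> nat list \<Rightarrow> (nat \<Rightarrow> nat) \<Rightarrow> complex" where
  "row_symmetrizer d \<mu> = (\<Sum>p\<in>row_group d \<mu>. ga_basis p)"

definition column_antisymmetrizer :: "nat \<Rightarrow> nat list \<Rightarrow> (nat \<Rightarrow> nat) \<Rightarrow> complex" where
  "column_antisymmetrizer d \<mu> =
     (\<Sum>q\<in>column_group d \<mu>. cfun_scale (of_int (sign q)) (ga_basis q))"

definition young_symmetrizer :: "nat \<Rightarrow> nat list \<Rightarrow> (nat \<Rightarrow> nat) \<Rightarrow> complex" where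
  "young_symmetrizer d \<mu> =
     ga_mult (sym_group d) (row_symmetrizer d \<mu>) (column_antisymmetrizer d \<mu>)"

definition specht_module :: "nat \<Rightarrow> nat list \<Rightarrow> ((nat \<Rightarrow> nat) \<Rightarrow> complex) set" where
  "specht_module d \<mu> =
     (\<lambda>x. ga_mult (sym_group d) x (young_symmetrizer d \<mu>)) ` group_algebra (sym_group d)"

definition specht_rep ::
  "nat \<Rightarrow> (nat \<Rightarrow> nat) \<Rightarrow> ((nat \<Rightarrow> nat) \<Rightarrow> complex) \<Rightarrow> ((nat \<Rightarrow> nat) \<Rightarrow> complex)" where
  "specht_rep d \<tau> = ga_mult (sym_group d) (ga_basis \<tau>)"

definition specht_character :: "nat \<Rightarrow> nat list \<Rightarrow> (nat \<Rightarrow> nat) \<Rightarrow> complex" where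
  "specht_character d \<mu> \<tau> = cfun.trace_on (specht_module d \<mu>) (specht_rep d \<tau>)"


section \<open>The signed Frobenius-Schur indicator\<close>

definition signed_FS_indicator ::
  "('a, 'm) monoid_scheme \<Rightarrow> ('a \<Rightarrow> int) \<Rightarrow> ('a \<Rightarrow> complex) \<Rightarrow> complex" where
  "signed_FS_indicator G \<epsilon> \<chi> =
     (\<Sum>\<tau>\<in>carrier G. of_int (\<epsilon> \<tau>) * \<chi> (\<tau> \<otimes>\<^bsub>G\<^esub> \<tau>)) / of_nat (order G)"

definition SFS :: "nat \<Rightarrow> nat list \<Rightarrow> complex" where
  "SFS d \<mu> = signed_FS_indicator (sym_group d) sign (specht_character d \<mu>)"

text \<open>The exponent \<open>(d - r(\<mu>)) / 2\<close> is an integer when \<open>\<mu>\<^sup>T = \<mu>\<close>, so it may be written with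
  truncating operations on \<open>nat\<close>.\<close>

lemma finite_young_diagram: "finite (young_diagram \<mu>)"
proof -
  have "young_diagram \<mu> = (SIGMA i:{..<length \<mu>}. {..<\<mu> ! i})"
    by (auto simp: young_diagram_def)
  then show ?thesis by simp
qed

lemma exponent_integral:
  assumes "is_partition d \<mu>" and "conj_partition \<mu> = \<mu>"
  shows "2 * ((d - diag_length \<mu>) div 2) + diag_length \<mu> = d"
proof -
  let ?Y = "young_diagram \<mu>"
  define A where "A = {(i, j) \<in> ?Y. i < j}"
  define B where "B = {(i, j) \<in> ?Y. j < i}"
  define D where "D = {(i, j) \<in> ?Y. i = j}"
  have swap: "prod.swap ` ?Y = ?Y"
    using young_diagram_conj[OF assms(1)] assms(2) by simp
  have fin: "finite A" "finite B" "finite D"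
    unfolding A_def B_def D_def by (auto intro: finite_subset[OF _ finite_young_diagram[of \<mu>]])
  have sym: "(i, j) \<in> ?Y \<longleftrightarrow> (j, i) \<in> ?Y" for i j
    using swap by (metis (no_types) pair_in_swap_image)
  have "B = prod.swap ` A"
    using sym by (auto simp: A_def B_def image_iff)
  then have AB: "card B = card A"
    by (simp add: card_image)
  have "D = (\<lambda>i. (i, i)) ` {i. i < length \<mu> \<and> \<mu> ! i \<ge> Suc i}"
    by (auto simp: D_def young_diagram_def)
  then have D: "card D = diag_length \<mu>"
    by (simp add: diag_length_def card_image inj_on_def)
  have "?Y = A \<union> B \<union> D"
    by (auto simp: A_def B_def D_def)
  moreover have "A \<inter> B = {}" "(A \<union> B) \<inter> D = {}"
    by (auto simp: A_def B_def D_def)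
  ultimately have "card ?Y = card A + card B + card D"
    using fin by (metis card_Un_disjoint finite_UnI)
  then have "d = 2 * card A + diag_length \<mu>"
    using AB D assms(1) by (simp add: card_young_diagram is_partition_def)
  then show ?thesis by simp
qed

end

theory Submission
  imports Defs
begin

text \<open>
  Let \<open>c = \<Sum> sign(q) p q\<close>, with \<open>p\<close> in the row group \<open>R\<close> and \<open>q\<close> in the column group \<open>C\<close>, be the
  Young symmetrizer, and write \<open>c(g)\<close> for its coefficients. Up to scalars, \<open>c\<close> is the only element
  of the group algebra with \<open>c(p g q) = sign(q) c(g)\<close> (\<open>equivariant_unique\<close>): if \<open>g\<close> is not of
  the form \<open>p q\<close>, then two entries of a common row have their preimages under \<open>g\<close> in a common column
  (\<open>row_column_collision\<close>), and the transposition of the two entries forces the coefficient of \<open>g\<close>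
  to vanish. Hence \<open>c x c\<close> is a multiple of
  \<open>c\<close> for every \<open>x\<close>; in particular \<open>c\<^sup>2 = n c\<close>. Here \<open>n > 0\<close> because \<open>n |R|\<^sup>2\<close> is a sum of squares,
  one of which is positive (\<open>sandwich_scalar_pos\<close>).

  Since \<open>c / n\<close> is idempotent, the character of the left ideal generated by \<open>c\<close> at \<open>\<tau>\<close> is the
  sum \<open>(1 / n) \<Sum>\<^sub>h c(h\<inverse> \<tau>\<inverse> h)\<close>, and the signed Frobenius-Schur indicator becomes
  \<open>S / n\<close> with \<open>S = \<Sum>\<^sub>\<tau> sign(\<tau>) c(\<tau>\<^sup>2)\<close> (\<open>signed_FS_indicator_left_ideal\<close>). Expanding one factor \<open>c\<close>
  as \<open>c\<^sup>2 / n\<close> and substituting gives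
  \<open>n S = \<Sum>\<^sub>k sign(k) \<Sum>\<^sub>u sign(u) c(u) c(k u k)\<close> (\<open>sandwich_scalar_signed_square_sum\<close>).

  Multiplication of \<open>u\<close> by a suitable transposition reverses the sign of the inner sum for \<open>k\<close>, so
  that it vanishes, as soon as two entries lie in one row both before and after applying \<open>k\<inverse>\<close>, or
  in one column both before and after applying \<open>k\<close>. If neither happens, then each row
  meets every row of the permuted tableau at most once, so at most \<open>m\<close> of its entries can come to lie
  in the first \<open>m\<close> rows. Hence the first \<open>m\<close> rows contain at most as many cells as the first \<open>m\<close>
  columns; the columns give the reverse inequality. So \<open>S \<noteq> 0\<close> forces the diagram to be symmetric.

  If the diagram is symmetric, let \<open>t\<close> be the involution of the entries that transposes the tableau.
  Conjugation by \<open>t\<close> exchanges \<open>R\<close> and \<open>C\<close>, hence \<open>sign(g) c(t g\<inverse> t)\<close> has the equivariance that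
  characterises \<open>c\<close>, and so it equals \<open>c(g)\<close>. Using this twice, the double sum for \<open>n S\<close> turns into
  \<open>sign(t)\<close> times the coefficient of the identity in \<open>c\<^sup>3\<close>, that is \<open>sign(t) n\<^sup>2\<close>. The indicator is
  therefore \<open>sign(t)\<close>; and \<open>t\<close> fixes exactly the entries on the diagonal, so it is a product of
  \<open>(d - r(\<mu>)) / 2\<close> transpositions.
\<close>

section \<open>Young symmetrizers in a finite group with a sign\<close>

context group begin

lemma inv_cancel_left [simp]:
  "x \<in> carrier G \<Longrightarrow> y \<in> carrier G \<Longrightarrow> inv x \<otimes> (x \<otimes> y) = y"
  "x \<in> carrier G \<Longrightarrow> y \<in> carrier G \<Longrightarrow> x \<otimes> (inv x \<otimes> y) = y"
  by (simp_all flip: m_assoc)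

lemma sum_mult_left:
  assumes "subgroup H G" "x \<in> H"
  shows "(\<Sum>h\<in>H. f (x \<otimes> h)) = sum f H"
proof (rule sum.reindex_bij_witness[where i = "\<lambda>h. inv x \<otimes> h" and j = "\<lambda>h. x \<otimes> h"])
qed (use assms subgroup.mem_carrier[OF assms(1)] in
      \<open>auto simp: subgroup.m_closed subgroup.m_inv_closed\<close>)

lemma sum_mult_right:
  assumes "subgroup H G" "x \<in> H"
  shows "(\<Sum>h\<in>H. f (h \<otimes> x)) = sum f H"
proof (rule sum.reindex_bij_witness[where i = "\<lambda>h. h \<otimes> inv x" and j = "\<lambda>h. h \<otimes> x"])
qed (use assms subgroup.mem_carrier[OF assms(1)] in
      \<open>auto simp: subgroup.m_closed subgroup.m_inv_closed m_assoc\<close>)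

lemma sum_inv: "(\<Sum>h\<in>carrier G. f (inv h)) = sum f (carrier G)"
  by (rule sum.reindex_bij_witness[where i = "\<lambda>h. inv h" and j = "\<lambda>h. inv h"]) auto

lemmas sum_carrier_mult_left = sum_mult_left[OF subgroup_self]
lemmas sum_carrier_mult_right = sum_mult_right[OF subgroup_self]

end

text \<open>
  The group theory behind the Young symmetrizer: \<open>R\<close> and \<open>C\<close> stand for the row and column groups.
  The last assumption replaces all combinatorics of tableaux; for a tableau, \<open>s\<close> is a transposition.
\<close>
locale young_pair = group G for G (structure) +
  fixes \<epsilon> :: "'a \<Rightarrow> int" and R C :: "'a set"
  assumes finite_G: "finite (carrier G)"
    and sign_mult: "\<And>x y. x \<in> carrier G \<Longrightarrow> y \<in> carrier G \<Longrightarrow> \<epsilon> (x \<otimes> y) = \<epsilon> x * \<epsilon> y"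
    and sign_cases: "\<And>x. x \<in> carrier G \<Longrightarrow> \<epsilon> x = 1 \<or> \<epsilon> x = - 1"
    and R: "subgroup R G" and C: "subgroup C G"
    and R_C_disjoint: "R \<inter> C = {\<one>}"
    and odd_conjugate: "\<And>g. g \<in> carrier G \<Longrightarrow> (\<forall>p\<in>R. inv p \<otimes> g \<notin> C) \<Longrightarrow>
      \<exists>s\<in>R. \<epsilon> s = - 1 \<and> inv g \<otimes> s \<otimes> g \<in> C"
begin

lemma R_carrier [simp]: "p \<in> R \<Longrightarrow> p \<in> carrier G"
  using R by (rule subgroup.mem_carrier)

lemma C_carrier [simp]: "q \<in> C \<Longrightarrow> q \<in> carrier G"
  using C by (rule subgroup.mem_carrier)

lemma finite_R: "finite R"
  by (rule finite_subset[OF subgroup.subset[OF R] finite_G])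

lemma sign_one: "\<epsilon> \<one> = 1"
  using sign_mult[of \<one> \<one>] sign_cases[of \<one>] by (metis one_closed l_one mult_minus1 add.inverse_inverse)

lemma sign_sq [simp]: "x \<in> carrier G \<Longrightarrow> \<epsilon> x * \<epsilon> x = 1"
  using sign_cases[of x] by auto

lemma sign_sq_left [simp]: "x \<in> carrier G \<Longrightarrow> \<epsilon> x * (\<epsilon> x * z) = z"
  by (simp flip: mult.assoc)

lemma sign_inv [simp]: "x \<in> carrier G \<Longrightarrow> \<epsilon> (inv x) = \<epsilon> x"
  using sign_mult[of x "inv x"] sign_cases[of x] by (auto simp: sign_one)

definition col_sign :: "'a \<Rightarrow> int" where
  "col_sign x = (if x \<in> C then \<epsilon> x else 0)"

text \<open>
  The coefficient of \<open>g\<close> in \<open>(\<Sum>p\<in>R. p) (\<Sum>q\<in>C. \<epsilon>(q) q)\<close>. It is an integer, and positivity of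
  sums of squares of coefficients will be used.
\<close>
definition symmetrizer :: "'a \<Rightarrow> int" where
  "symmetrizer g = (\<Sum>p\<in>R. col_sign (inv p \<otimes> g))"

definition equivariant :: "('a \<Rightarrow> int) \<Rightarrow> bool" where
  "equivariant f \<longleftrightarrow>
     (\<forall>p\<in>R. \<forall>g\<in>carrier G. f (p \<otimes> g) = f g) \<and>
     (\<forall>q\<in>C. \<forall>g\<in>carrier G. f (g \<otimes> q) = \<epsilon> q * f g)"

lemma C_mult_iff:
  assumes "x \<in> carrier G" "q \<in> C"
  shows "x \<otimes> q \<in> C \<longleftrightarrow> x \<in> C"
proof
  assume "x \<otimes> q \<in> C"
  then have "x \<otimes> q \<otimes> inv q \<in> C"
    using assms by (simp add: subgroup.m_closed[OF C] subgroup.m_inv_closed[OF C])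
  then show "x \<in> C" using assms by (simp add: m_assoc)
qed (simp add: assms subgroup.m_closed[OF C])

lemma col_sign_mult:
  "x \<in> carrier G \<Longrightarrow> q \<in> C \<Longrightarrow> col_sign (x \<otimes> q) = \<epsilon> q * col_sign x"
  by (simp add: col_sign_def C_mult_iff sign_mult)

lemma col_sign_inv:
  assumes "x \<in> carrier G"
  shows "col_sign (inv x) = col_sign x"
proof -
  have "inv x \<in> C \<longleftrightarrow> x \<in> C"
    using subgroup.m_inv_closed[OF C] assms by (metis inv_inv)
  then show ?thesis using assms by (simp add: col_sign_def)
qed

lemma equivariant_symmetrizer: "equivariant symmetrizer"
  unfolding equivariant_def
proof (intro conjI ballI)
  fix p g assume p: "p \<in> R" and g: "g \<in> carrier G"
  have "symmetrizer (p \<otimes> g) = (\<Sum>r\<in>R. col_sign (inv (p \<otimes> r) \<otimes> (p \<otimes> g)))"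
    unfolding symmetrizer_def using sum_mult_left[OF R p, of "\<lambda>r. col_sign (inv r \<otimes> (p \<otimes> g))"] by simp
  also have "\<dots> = symmetrizer g"
    unfolding symmetrizer_def using p g by (intro sum.cong) (auto simp: inv_mult_group m_assoc)
  finally show "symmetrizer (p \<otimes> g) = symmetrizer g" .
next
  fix q g assume "q \<in> C" "g \<in> carrier G"
  then show "symmetrizer (g \<otimes> q) = \<epsilon> q * symmetrizer g"
    by (simp add: symmetrizer_def sum_distrib_left col_sign_mult flip: m_assoc)
qed

lemmas symmetrizer_left = equivariant_symmetrizer[unfolded equivariant_def, THEN conjunct1, rule_format]
lemmas symmetrizer_right = equivariant_symmetrizer[unfolded equivariant_def, THEN conjunct2, rule_format]

lemma symmetrizer_one: "symmetrizer \<one> = 1"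
proof -
  have "col_sign (inv p \<otimes> \<one>) = (if p = \<one> then 1 else 0)" if "p \<in> R" for p
  proof -
    have "p \<in> C \<longleftrightarrow> p = \<one>" using that R_C_disjoint by blast
    moreover have "col_sign (inv p \<otimes> \<one>) = col_sign p"
      using that by (simp add: col_sign_inv)
    ultimately show ?thesis by (simp add: col_sign_def sign_one)
  qed
  then show ?thesis
    using subgroup.one_closed[OF R] finite_R by (simp add: symmetrizer_def)
qed

text \<open>
  With \<open>s\<close> odd in \<open>R\<close> and \<open>s' = g\<inverse> s g\<close> in \<open>C\<close>, the equation \<open>s g = g s'\<close> gives \<open>f(g) = -f(g)\<close>.
\<close>
lemma equivariant_vanishes:
  assumes f: "equivariant f" and g: "g \<in> carrier G" and "\<forall>p\<in>R. inv p \<otimes> g \<notin> C"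
  shows "f g = 0"
proof -
  obtain s where s: "s \<in> R" "\<epsilon> s = - 1" "inv g \<otimes> s \<otimes> g \<in> C"
    using odd_conjugate assms(2,3) by blast
  have "f g = f (s \<otimes> g)"
    using f s(1) g by (simp add: equivariant_def)
  also have "s \<otimes> g = g \<otimes> (inv g \<otimes> s \<otimes> g)"
    using s(1) g by (simp add: m_assoc)
  also have "f \<dots> = \<epsilon> (inv g \<otimes> s \<otimes> g) * f g"
    using f s(3) g by (simp add: equivariant_def)
  also have "\<epsilon> (inv g \<otimes> s \<otimes> g) = - 1"
    using s g by (simp add: sign_mult)
  finally show ?thesis by simp
qed

text \<open>
  Both sides are determined on \<open>R C\<close> by their value at the identity, and vanish elsewhere. Every
  later identity between coefficients of the symmetrizer is obtained by verifying equivariance.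
\<close>
lemma equivariant_unique:
  assumes f: "equivariant f" and g: "g \<in> carrier G"
  shows "f g = f \<one> * symmetrizer g"
proof (cases "\<exists>p\<in>R. inv p \<otimes> g \<in> C")
  case True
  then obtain p where p: "p \<in> R" "inv p \<otimes> g \<in> C" by blast
  define q where "q = inv p \<otimes> g"
  have q: "q \<in> C" and g_eq: "g = p \<otimes> q"
    using p g by (simp_all add: q_def)
  have eval: "h g = \<epsilon> q * h \<one>" if "equivariant h" for h
  proof -
    have "h g = h (\<one> \<otimes> q)"
      using that p(1) q by (simp add: equivariant_def g_eq)
    also have "\<dots> = \<epsilon> q * h \<one>"
      using that q unfolding equivariant_def by blast
    finally show ?thesis .
  qed
  show ?thesis using eval[OF f] eval[OF equivariant_symmetrizer] by (simp add: symmetrizer_one)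
next
  case False
  then show ?thesis
    using equivariant_vanishes[OF f g] equivariant_vanishes[OF equivariant_symmetrizer g] by simp
qed

text \<open>
  The scalar \<open>\<lambda>\<close> in \<open>c y\<inverse> c = \<lambda> c\<close>; for \<open>y = \<one>\<close> it is the number \<open>n\<close> with \<open>c\<^sup>2 = n c\<close>.
\<close>
definition sandwich_scalar :: "'a \<Rightarrow> int" where
  "sandwich_scalar y = (\<Sum>w\<in>carrier G. symmetrizer w * symmetrizer (y \<otimes> inv w))"

text \<open>The left-hand side is the coefficient of \<open>g\<close> in \<open>c y\<inverse> c\<close>, which inherits equivariance from
  the two outer factors.\<close>
lemma sandwich:
  assumes y: "y \<in> carrier G" and g: "g \<in> carrier G"
  shows "(\<Sum>w\<in>carrier G. symmetrizer w * symmetrizer (y \<otimes> inv w \<otimes> g)) = sandwich_scalar y * symmetrizer g"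
proof -
  let ?f = "\<lambda>g. \<Sum>w\<in>carrier G. symmetrizer w * symmetrizer (y \<otimes> inv w \<otimes> g)"
  have "equivariant ?f"
    unfolding equivariant_def
  proof (intro conjI ballI)
    fix p g assume p: "p \<in> R" and g: "g \<in> carrier G"
    have "?f (p \<otimes> g) = (\<Sum>w\<in>carrier G. symmetrizer (p \<otimes> w) * symmetrizer (y \<otimes> inv (p \<otimes> w) \<otimes> (p \<otimes> g)))"
      using sum_carrier_mult_left[of p "\<lambda>w. symmetrizer w * symmetrizer (y \<otimes> inv w \<otimes> (p \<otimes> g))"] p by simp
    also have "\<dots> = ?f g"
      using p g y by (intro sum.cong) (simp_all add: symmetrizer_left inv_mult_group m_assoc)
    finally show "?f (p \<otimes> g) = ?f g" .
  next
    fix q g assume "q \<in> C" "g \<in> carrier G"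
    then show "?f (g \<otimes> q) = \<epsilon> q * ?f g"
      using y by (simp add: symmetrizer_right sum_distrib_left ac_simps flip: m_assoc)
  qed
  then have "?f g = ?f \<one> * symmetrizer g" using g by (rule equivariant_unique)
  then show ?thesis using y by (simp add: sandwich_scalar_def)
qed

lemma symmetrizer_convolve:
  assumes "g \<in> carrier G"
  shows "(\<Sum>w\<in>carrier G. symmetrizer w * symmetrizer (inv w \<otimes> g)) = sandwich_scalar \<one> * symmetrizer g"
  using sandwich[of \<one> g] assms by simp

text \<open>
  Let \<open>a = \<Sum>p\<in>R. p\<close> and let \<open>u\<close> be the coefficients of \<open>c a\<close>. This element has the form \<open>a b a\<close> and
  is fixed by the anti-automorphism \<open>g \<mapsto> g\<inverse>\<close>, so the coefficient of the identity in \<open>(c a)\<^sup>2\<close>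
  is a sum of squares; on the other hand it is \<open>n |R|\<^sup>2\<close>.
\<close>
lemma sandwich_scalar_pos: "sandwich_scalar \<one> > 0"
proof -
  define u where "u g = (\<Sum>p\<in>R. symmetrizer (g \<otimes> p))" for g
  have u_one: "u \<one> = card R"
    using symmetrizer_left[of _ \<one>] by (simp add: u_def symmetrizer_one)
  have u_inv: "u (inv g) = u g" if g: "g \<in> carrier G" for g
  proof -
    have "u (inv g) = (\<Sum>p\<in>R. \<Sum>r\<in>R. col_sign (inv (inv r \<otimes> (inv g \<otimes> p))))"
      using g by (simp add: u_def symmetrizer_def col_sign_inv)
    also have "\<dots> = (\<Sum>p\<in>R. \<Sum>r\<in>R. col_sign (inv p \<otimes> (g \<otimes> r)))"
      using g by (intro sum.cong) (simp_all add: inv_mult_group m_assoc)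
    also have "\<dots> = u g"
      unfolding u_def symmetrizer_def by (rule sum.swap)
    finally show ?thesis .
  qed
  have "(\<Sum>g\<in>carrier G. u g * u g) = (\<Sum>g\<in>carrier G. u g * u (inv g))"
    by (simp add: u_inv)
  also have "\<dots> = (\<Sum>g\<in>carrier G. \<Sum>p\<in>R. \<Sum>r\<in>R. symmetrizer (g \<otimes> p) * symmetrizer (inv g \<otimes> r))"
    by (simp add: u_def sum_product)
  also have "\<dots> = (\<Sum>p\<in>R. \<Sum>r\<in>R. \<Sum>g\<in>carrier G. symmetrizer (g \<otimes> p) * symmetrizer (inv g \<otimes> r))"
    by (subst sum.swap) (intro sum.cong refl sum.swap)
  also have "\<dots> = (\<Sum>p\<in>R. \<Sum>r\<in>R. sandwich_scalar \<one>)"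
  proof (intro sum.cong refl)
    fix p r assume p: "p \<in> R" and r: "r \<in> R"
    have "(\<Sum>g\<in>carrier G. symmetrizer (g \<otimes> p) * symmetrizer (inv g \<otimes> r)) =
        (\<Sum>g\<in>carrier G. symmetrizer (g \<otimes> p) * symmetrizer (p \<otimes> (inv (g \<otimes> p) \<otimes> r)))"
      using p r by (intro sum.cong) (simp_all add: inv_mult_group m_assoc)
    also have "\<dots> = (\<Sum>g\<in>carrier G. symmetrizer g * symmetrizer (p \<otimes> (inv g \<otimes> r)))"
      using sum_carrier_mult_right[of p "\<lambda>g. symmetrizer g * symmetrizer (p \<otimes> (inv g \<otimes> r))"] p by simp
    also have "\<dots> = (\<Sum>g\<in>carrier G. symmetrizer g * symmetrizer (inv g \<otimes> r))"
      using p r by (intro sum.cong) (simp_all add: symmetrizer_left)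
    also have "\<dots> = sandwich_scalar \<one>"
      using symmetrizer_convolve[of r] symmetrizer_left[of r \<one>] r by (simp add: symmetrizer_one)
    finally show "(\<Sum>g\<in>carrier G. symmetrizer (g \<otimes> p) * symmetrizer (inv g \<otimes> r)) = sandwich_scalar \<one>" .
  qed
  finally have eq: "(\<Sum>g\<in>carrier G. u g * u g) = int (card R) * (int (card R) * sandwich_scalar \<one>)"
    by simp
  have "card R > 0"
    using finite_R subgroup.one_closed[OF R] by (auto simp: card_gt_0_iff)
  then have "0 < u \<one> * u \<one>" by (simp add: u_one)
  also have "\<dots> \<le> (\<Sum>g\<in>carrier G. u g * u g)"
    by (rule member_le_sum) (simp_all add: finite_G)
  finally show ?thesis
    using \<open>card R > 0\<close> unfolding eq by (simp add: zero_less_mult_iff)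
qed

text \<open>Divided by \<open>sandwich_scalar \<one>\<close>, this is the signed Frobenius-Schur indicator of the left
  ideal generated by the symmetrizer.\<close>
definition signed_square_sum :: int where
  "signed_square_sum = (\<Sum>\<tau>\<in>carrier G. \<epsilon> \<tau> * symmetrizer (\<tau> \<otimes> \<tau>))"

text \<open>
  Expand \<open>n c(\<tau>\<^sup>2)\<close> as the coefficient \<open>\<Sum>\<^sub>k c(\<tau> k) c(k\<inverse> \<tau>)\<close> of \<open>c\<^sup>2\<close>, then substitute \<open>\<tau> = k u\<close>.
\<close>
lemma sandwich_scalar_signed_square_sum:
  "sandwich_scalar \<one> * signed_square_sum =
     (\<Sum>k\<in>carrier G. \<epsilon> k * (\<Sum>u\<in>carrier G. \<epsilon> u * symmetrizer u * symmetrizer (k \<otimes> u \<otimes> k)))"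
proof -
  have "sandwich_scalar \<one> * signed_square_sum =
      (\<Sum>\<tau>\<in>carrier G. \<epsilon> \<tau> * (\<Sum>w\<in>carrier G. symmetrizer w * symmetrizer (inv w \<otimes> (\<tau> \<otimes> \<tau>))))"
    unfolding signed_square_sum_def sum_distrib_left
    by (intro sum.cong refl) (subst sum_distrib_left[symmetric], subst symmetrizer_convolve, auto)
  also have "\<dots> = (\<Sum>\<tau>\<in>carrier G. \<epsilon> \<tau> *
      (\<Sum>k\<in>carrier G. symmetrizer (\<tau> \<otimes> k) * symmetrizer (inv (\<tau> \<otimes> k) \<otimes> (\<tau> \<otimes> \<tau>))))"
    by (intro sum.cong refl arg_cong2[where f = "(*)"]
        sum_carrier_mult_left[symmetric, where f = "\<lambda>w. symmetrizer w * symmetrizer (inv w \<otimes> (_ \<otimes> _))"])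
  also have "\<dots> = (\<Sum>\<tau>\<in>carrier G. \<Sum>k\<in>carrier G. \<epsilon> \<tau> * (symmetrizer (\<tau> \<otimes> k) * symmetrizer (inv k \<otimes> \<tau>)))"
    unfolding sum_distrib_left by (intro sum.cong refl) (simp add: inv_mult_group m_assoc)
  also have "\<dots> = (\<Sum>k\<in>carrier G. \<Sum>\<tau>\<in>carrier G. \<epsilon> \<tau> * (symmetrizer (\<tau> \<otimes> k) * symmetrizer (inv k \<otimes> \<tau>)))"
    by (rule sum.swap)
  also have "\<dots> = (\<Sum>k\<in>carrier G. \<Sum>u\<in>carrier G.
      \<epsilon> (k \<otimes> u) * (symmetrizer (k \<otimes> u \<otimes> k) * symmetrizer (inv k \<otimes> (k \<otimes> u))))"
  proof (rule sum.cong[OF refl])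
    fix k assume "k \<in> carrier G"
    then show "(\<Sum>\<tau>\<in>carrier G. \<epsilon> \<tau> * (symmetrizer (\<tau> \<otimes> k) * symmetrizer (inv k \<otimes> \<tau>))) =
        (\<Sum>u\<in>carrier G. \<epsilon> (k \<otimes> u) * (symmetrizer (k \<otimes> u \<otimes> k) * symmetrizer (inv k \<otimes> (k \<otimes> u))))"
      by (rule sum_carrier_mult_left[symmetric,
            where f = "\<lambda>\<tau>. \<epsilon> \<tau> * (symmetrizer (\<tau> \<otimes> k) * symmetrizer (inv k \<otimes> \<tau>))"])
  qed
  also have "\<dots> = (\<Sum>k\<in>carrier G. \<epsilon> k * (\<Sum>u\<in>carrier G. \<epsilon> u * symmetrizer u * symmetrizer (k \<otimes> u \<otimes> k)))"
    unfolding sum_distrib_left by (intro sum.cong refl) (simp add: sign_mult ac_simps)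
  finally show ?thesis .
qed

text \<open>
  For each \<open>k\<close> the inner sum over \<open>u\<close> is reversed by \<open>u \<mapsto> s' u\<close> with \<open>s' = k\<inverse> s k\<close> in the first
  case: only \<open>\<epsilon>(u)\<close> changes sign. In the second case \<open>u \<mapsto> u s'\<close> with \<open>s' = k s k\<inverse>\<close> changes the
  sign of all three factors.
\<close>
lemma signed_square_sum_zero:
  assumes "\<And>k. k \<in> carrier G \<Longrightarrow>
    (\<exists>s\<in>R. \<epsilon> s = - 1 \<and> inv k \<otimes> s \<otimes> k \<in> R) \<or> (\<exists>s\<in>C. \<epsilon> s = - 1 \<and> k \<otimes> s \<otimes> inv k \<in> C)"
  shows "signed_square_sum = 0"
proof -
  have "(\<Sum>u\<in>carrier G. \<epsilon> u * symmetrizer u * symmetrizer (k \<otimes> u \<otimes> k)) = 0" (is "?F = 0")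
    if k: "k \<in> carrier G" for k
    using assms[OF k]
  proof
    assume "\<exists>s\<in>R. \<epsilon> s = - 1 \<and> inv k \<otimes> s \<otimes> k \<in> R"
    then obtain s where s: "s \<in> R" "\<epsilon> s = - 1" "inv k \<otimes> s \<otimes> k \<in> R" by blast
    define s' where "s' = inv k \<otimes> s \<otimes> k"
    have s': "s' \<in> R" "\<epsilon> s' = - 1" "k \<otimes> s' = s \<otimes> k"
      using s k by (simp_all add: s'_def sign_mult m_assoc)
    have "?F = (\<Sum>u\<in>carrier G. \<epsilon> (s' \<otimes> u) * symmetrizer (s' \<otimes> u) * symmetrizer (k \<otimes> (s' \<otimes> u) \<otimes> k))"
      using sum_carrier_mult_left[of s' "\<lambda>u. \<epsilon> u * symmetrizer u * symmetrizer (k \<otimes> u \<otimes> k)"] s' by simp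
    also have "\<dots> = (\<Sum>u\<in>carrier G. - (\<epsilon> u * symmetrizer u * symmetrizer (k \<otimes> u \<otimes> k)))"
    proof (intro sum.cong refl)
      fix u assume u: "u \<in> carrier G"
      have "k \<otimes> (s' \<otimes> u) \<otimes> k = s \<otimes> (k \<otimes> u \<otimes> k)"
        using s'(3) s(1) s'(1) k u by (metis (no_types, lifting) R_carrier m_assoc m_closed)
      then show "\<epsilon> (s' \<otimes> u) * symmetrizer (s' \<otimes> u) * symmetrizer (k \<otimes> (s' \<otimes> u) \<otimes> k) =
          - (\<epsilon> u * symmetrizer u * symmetrizer (k \<otimes> u \<otimes> k))"
        using s s' k u by (simp add: sign_mult symmetrizer_left)
    qed
    finally show ?thesis by (simp add: sum_negf)
  next
    assume "\<exists>s\<in>C. \<epsilon> s = - 1 \<and> k \<otimes> s \<otimes> inv k \<in> C"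
    then obtain s where s: "s \<in> C" "\<epsilon> s = - 1" "k \<otimes> s \<otimes> inv k \<in> C" by blast
    define s' where "s' = k \<otimes> s \<otimes> inv k"
    have s': "s' \<in> C" "\<epsilon> s' = - 1" "s' \<otimes> k = k \<otimes> s"
      using s k by (simp_all add: s'_def sign_mult m_assoc)
    have "?F = (\<Sum>u\<in>carrier G. \<epsilon> (u \<otimes> s') * symmetrizer (u \<otimes> s') * symmetrizer (k \<otimes> (u \<otimes> s') \<otimes> k))"
      using sum_carrier_mult_right[of s' "\<lambda>u. \<epsilon> u * symmetrizer u * symmetrizer (k \<otimes> u \<otimes> k)"] s' by simp
    also have "\<dots> = (\<Sum>u\<in>carrier G. - (\<epsilon> u * symmetrizer u * symmetrizer (k \<otimes> u \<otimes> k)))"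
    proof (intro sum.cong refl)
      fix u assume u: "u \<in> carrier G"
      have "k \<otimes> (u \<otimes> s') \<otimes> k = (k \<otimes> u \<otimes> k) \<otimes> s"
        using s'(3) s(1) s'(1) k u by (metis (no_types, lifting) C_carrier m_assoc m_closed)
      then show "\<epsilon> (u \<otimes> s') * symmetrizer (u \<otimes> s') * symmetrizer (k \<otimes> (u \<otimes> s') \<otimes> k) =
          - (\<epsilon> u * symmetrizer u * symmetrizer (k \<otimes> u \<otimes> k))"
        using s s' k u by (simp add: sign_mult symmetrizer_right)
    qed
    finally show ?thesis by (simp add: sum_negf)
  qed
  then have "sandwich_scalar \<one> * signed_square_sum = 0"
    unfolding sandwich_scalar_signed_square_sum by simp
  then show ?thesis using sandwich_scalar_pos by simp
qed

text \<open>
  Conjugation by \<open>t\<close> makes \<open>g \<mapsto> \<epsilon>(g) c(t g\<inverse> t)\<close> equivariant, so it is \<open>c\<close> (the fact \<open>twist\<close>).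
  The first use of this collapses the sum over \<open>u\<close> by the sandwich identity; the second turns the
  remaining sum into the coefficient of the identity in \<open>c\<^sup>3\<close>.
\<close>
lemma signed_square_sum_swap:
  assumes t: "t \<in> carrier G" "t \<otimes> t = \<one>"
    and tR: "\<And>p. p \<in> R \<Longrightarrow> t \<otimes> p \<otimes> t \<in> C" and tC: "\<And>q. q \<in> C \<Longrightarrow> t \<otimes> q \<otimes> t \<in> R"
  shows "signed_square_sum = \<epsilon> t * sandwich_scalar \<one>"
proof -
  have inv_t: "inv t = t" using t by (metis inv_equality)
  have tt: "t \<otimes> (t \<otimes> x) = x" if "x \<in> carrier G" for x
    using that t by (simp flip: m_assoc)
  \<comment> \<open>Conjugating by \<open>t\<close> exchanges rows and columns, so this substitution is the one that the
    identity \<open>twist\<close> below can absorb.\<close>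
  have reindex: "sum f (carrier G) = (\<Sum>g\<in>carrier G. f (t \<otimes> (inv g \<otimes> t)))" for f :: "'a \<Rightarrow> int"
    using sum_inv[of "\<lambda>g. f (t \<otimes> (g \<otimes> t))"]
      sum_carrier_mult_right[OF t(1), of "\<lambda>g. f (t \<otimes> g)"] sum_carrier_mult_left[OF t(1), of f]
    by simp
  have "equivariant (\<lambda>g. \<epsilon> g * symmetrizer (t \<otimes> (inv g \<otimes> t)))"
    unfolding equivariant_def
  proof (intro conjI ballI)
    fix p g assume p: "p \<in> R" and g: "g \<in> carrier G"
    have "t \<otimes> (inv (p \<otimes> g) \<otimes> t) = (t \<otimes> (inv g \<otimes> t)) \<otimes> (t \<otimes> inv p \<otimes> t)"
      using p g t by (simp add: inv_mult_group m_assoc tt)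
    then show "\<epsilon> (p \<otimes> g) * symmetrizer (t \<otimes> (inv (p \<otimes> g) \<otimes> t)) = \<epsilon> g * symmetrizer (t \<otimes> (inv g \<otimes> t))"
      using p g t tR[of "inv p"] subgroup.m_inv_closed[OF R p]
      by (simp add: symmetrizer_right sign_mult ac_simps)
  next
    fix q g assume q: "q \<in> C" and g: "g \<in> carrier G"
    have "t \<otimes> (inv (g \<otimes> q) \<otimes> t) = (t \<otimes> inv q \<otimes> t) \<otimes> (t \<otimes> (inv g \<otimes> t))"
      using q g t by (simp add: inv_mult_group m_assoc tt)
    then show "\<epsilon> (g \<otimes> q) * symmetrizer (t \<otimes> (inv (g \<otimes> q) \<otimes> t)) = \<epsilon> q * (\<epsilon> g * symmetrizer (t \<otimes> (inv g \<otimes> t)))"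
      using q g t tC[of "inv q"] subgroup.m_inv_closed[OF C q]
      by (simp add: symmetrizer_left sign_mult)
  qed
  from equivariant_unique[OF this]
  have "\<epsilon> g * symmetrizer (t \<otimes> (inv g \<otimes> t)) = symmetrizer g" if "g \<in> carrier G" for g
    using that t by (simp add: sign_one symmetrizer_one)
  then have twist: "\<epsilon> g * symmetrizer g = symmetrizer (t \<otimes> (inv g \<otimes> t))" if "g \<in> carrier G" for g
    using that by (metis sign_sq_left)
  have inner: "(\<Sum>u\<in>carrier G. \<epsilon> u * symmetrizer u * symmetrizer (k \<otimes> u \<otimes> k)) = sandwich_scalar (k \<otimes> t) * symmetrizer (t \<otimes> k)"
    if k: "k \<in> carrier G" for k
  proof -
    have "(\<Sum>u\<in>carrier G. \<epsilon> u * symmetrizer u * symmetrizer (k \<otimes> u \<otimes> k)) =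
        (\<Sum>u\<in>carrier G. symmetrizer (t \<otimes> (inv u \<otimes> t)) * symmetrizer (k \<otimes> u \<otimes> k))"
      by (intro sum.cong refl) (simp add: twist)
    also have "\<dots> = (\<Sum>w\<in>carrier G. symmetrizer w * symmetrizer (k \<otimes> t \<otimes> inv w \<otimes> (t \<otimes> k)))"
      by (subst reindex, intro sum.cong refl) (use t k in \<open>simp add: inv_mult_group inv_t m_assoc tt\<close>)
    also have "\<dots> = sandwich_scalar (k \<otimes> t) * symmetrizer (t \<otimes> k)"
      using sandwich t k by simp
    finally show ?thesis .
  qed
  have "sandwich_scalar \<one> * signed_square_sum =
      (\<Sum>k\<in>carrier G. \<epsilon> k * (sandwich_scalar (k \<otimes> t) * symmetrizer (t \<otimes> k)))"
    unfolding sandwich_scalar_signed_square_sum by (intro sum.cong refl) (simp add: inner)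
  also have "\<dots> = (\<Sum>m\<in>carrier G. \<epsilon> (t \<otimes> m) * (sandwich_scalar (t \<otimes> m \<otimes> t) * symmetrizer (t \<otimes> (t \<otimes> m))))"
    using sum_carrier_mult_left[OF t(1), of "\<lambda>k. \<epsilon> k * (sandwich_scalar (k \<otimes> t) * symmetrizer (t \<otimes> k))"] by simp
  also have "\<dots> = (\<Sum>m\<in>carrier G. \<epsilon> t * (sandwich_scalar (t \<otimes> (m \<otimes> t)) * symmetrizer (t \<otimes> (inv m \<otimes> t))))"
    using t by (intro sum.cong refl) (simp add: sign_mult tt m_assoc flip: twist)
  also have "\<dots> = (\<Sum>v\<in>carrier G. \<epsilon> t * (sandwich_scalar (inv v) * symmetrizer v))"
    by (subst reindex, intro sum.cong refl) (use t in \<open>simp add: inv_mult_group inv_t m_assoc tt\<close>)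
  also have "\<dots> = \<epsilon> t * (\<Sum>v\<in>carrier G. \<Sum>w\<in>carrier G. symmetrizer w * (symmetrizer v * symmetrizer (inv v \<otimes> inv w)))"
    by (simp add: sum_distrib_left sum_distrib_right sandwich_scalar_def ac_simps)
  also have "\<dots> = \<epsilon> t * (\<Sum>w\<in>carrier G. symmetrizer w * (\<Sum>v\<in>carrier G. symmetrizer v * symmetrizer (inv v \<otimes> inv w)))"
    unfolding sum_distrib_left by (rule sum.swap)
  also have "\<dots> = \<epsilon> t * (sandwich_scalar \<one> * sandwich_scalar \<one>)"
    by (simp add: symmetrizer_convolve sandwich_scalar_def[of \<one>] sum_distrib_left ac_simps)
  finally show ?thesis using sandwich_scalar_pos by simp
qed

end

section \<open>The indicator of a left ideal generated by a quasi-idempotent\<close>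

lemma sum_fun_apply: "(\<Sum>h\<in>H. F h) g = (\<Sum>h\<in>H. F h g)"
  by (induction H rule: infinite_finite_induct) auto

text \<open>
  A spanning family with coordinate functionals computes traces as a basis does. This allows the
  trace on a left ideal \<open>\<complex>[G] c\<close> to be read off from the family \<open>h c\<close> for \<open>h\<close> in \<open>G\<close>, without
  knowing any basis or even the dimension.
\<close>
lemma (in vector_space) trace_on_frame:
  assumes V: "subspace V" and I: "finite I" and v: "\<And>i. i \<in> I \<Longrightarrow> v i \<in> V"
    and \<phi>: "\<And>i. i \<in> I \<Longrightarrow> module_hom scale (*) (\<phi> i)"
    and frame: "\<And>x. x \<in> V \<Longrightarrow> (\<Sum>i\<in>I. scale (\<phi> i x) (v i)) = x"
    and f: "module_hom scale scale f" and f_V: "\<And>x. x \<in> V \<Longrightarrow> f x \<in> V"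
  shows "trace_on V f = (\<Sum>i\<in>I. \<phi> i (f (v i)))"
proof -
  define B where "B = (SOME B. independent B \<and> span B = V)"
  have "\<exists>B. independent B \<and> span B = V"
    using basis_exists[of V] span_subspace[OF _ _ V] by metis
  then have B: "independent B" "span B = V"
    unfolding B_def by (rule someI2_ex, blast)+
  have "V \<subseteq> span (v ` I)"
  proof
    fix x assume "x \<in> V"
    then have "x = (\<Sum>i\<in>I. scale (\<phi> i x) (v i))" by (simp add: frame)
    also have "\<dots> \<in> span (v ` I)" by (intro span_sum span_scale span_base) auto
    finally show "x \<in> span (v ` I)" .
  qed
  then have "finite B"
    using independent_span_bound[of "v ` I" B] I B span_superset[of B] by auto
  have rep: "representation B x b = (\<Sum>i\<in>I. \<phi> i x * representation B (v i) b)" if "x \<in> V" for x b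
  proof -
    have "representation B x b = representation B (\<Sum>i\<in>I. scale (\<phi> i x) (v i)) b"
      using that by (simp add: frame)
    also have "\<dots> = (\<Sum>i\<in>I. \<phi> i x * representation B (v i) b)"
      using v B V by (simp add: representation_sum representation_scale subspace_scale)
    finally show ?thesis .
  qed
  have "trace_on V f = (\<Sum>b\<in>B. representation B (f b) b)"
    by (simp add: trace_on_def B_def Let_def)
  also have "\<dots> = (\<Sum>b\<in>B. \<Sum>i\<in>I. representation B (v i) b * \<phi> i (f b))"
    using B f_V span_base[of _ B] by (simp add: rep mult.commute)
  also have "\<dots> = (\<Sum>i\<in>I. \<Sum>b\<in>B. representation B (v i) b * \<phi> i (f b))"
    by (rule sum.swap)
  also have "\<dots> = (\<Sum>i\<in>I. \<phi> i (f (v i)))"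
  proof (intro sum.cong refl)
    fix i assume i: "i \<in> I"
    have "\<phi> i (f (v i)) = \<phi> i (f (\<Sum>b\<in>B. scale (representation B (v i) b) b))"
      using sum_representation_eq[OF B(1), of "v i" B] B v i \<open>finite B\<close> by simp
    also have "\<dots> = (\<Sum>b\<in>B. representation B (v i) b * \<phi> i (f b))"
      by (simp add: module_hom.sum[OF f] module_hom.scale[OF f]
          module_hom.sum[OF \<phi>[OF i]] module_hom.scale[OF \<phi>[OF i]])
    finally show "(\<Sum>b\<in>B. representation B (v i) b * \<phi> i (f b)) = \<phi> i (f (v i))" ..
  qed
  finally show ?thesis .
qed

context group begin

lemma ga_mult_eq: "g \<in> carrier G \<Longrightarrow> ga_mult G x y g = (\<Sum>h\<in>carrier G. x h * y (inv h \<otimes> g))"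
  by (simp add: ga_mult_def)

lemma ga_mult_closed: "ga_mult G x y \<in> group_algebra G"
  by (simp add: ga_mult_def group_algebra_def)

lemma group_algebra_eqI:
  "x \<in> group_algebra G \<Longrightarrow> y \<in> group_algebra G \<Longrightarrow> (\<And>g. g \<in> carrier G \<Longrightarrow> x g = y g) \<Longrightarrow> x = y"
  by (rule ext) (metis (mono_tags, lifting) group_algebra_def mem_Collect_eq)

lemma ga_mult_assoc: "ga_mult G (ga_mult G x y) z = ga_mult G x (ga_mult G y z)"
proof (rule group_algebra_eqI)
  fix g assume g: "g \<in> carrier G"
  have "ga_mult G (ga_mult G x y) z g =
      (\<Sum>h\<in>carrier G. \<Sum>k\<in>carrier G. x k * (y (inv k \<otimes> h) * z (inv h \<otimes> g)))"
    using g by (simp add: ga_mult_eq sum_distrib_right mult.assoc)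
  also have "\<dots> = (\<Sum>k\<in>carrier G. \<Sum>h\<in>carrier G. x k * (y (inv k \<otimes> h) * z (inv h \<otimes> g)))"
    by (rule sum.swap)
  also have "\<dots> = (\<Sum>k\<in>carrier G. x k * ga_mult G y z (inv k \<otimes> g))"
  proof (intro sum.cong refl)
    fix k assume k: "k \<in> carrier G"
    have "(\<Sum>h\<in>carrier G. x k * (y (inv k \<otimes> h) * z (inv h \<otimes> g))) =
        (\<Sum>h\<in>carrier G. x k * (y (inv k \<otimes> (k \<otimes> h)) * z (inv (k \<otimes> h) \<otimes> g)))"
      using k by (rule sum_carrier_mult_left[symmetric,
            where f = "\<lambda>h. x k * (y (inv k \<otimes> h) * z (inv h \<otimes> g))"])
    also have "\<dots> = x k * ga_mult G y z (inv k \<otimes> g)"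
      using g k by (simp add: ga_mult_eq sum_distrib_left inv_mult_group m_assoc)
    finally show "(\<Sum>h\<in>carrier G. x k * (y (inv k \<otimes> h) * z (inv h \<otimes> g))) =
        x k * ga_mult G y z (inv k \<otimes> g)" .
  qed
  also have "\<dots> = ga_mult G x (ga_mult G y z) g"
    using g by (simp add: ga_mult_eq)
  finally show "ga_mult G (ga_mult G x y) z g = ga_mult G x (ga_mult G y z) g" .
qed (rule ga_mult_closed)+

lemma ga_mult_basis_left:
  assumes "finite (carrier G)" "\<tau> \<in> carrier G" "g \<in> carrier G"
  shows "ga_mult G (ga_basis \<tau>) y g = y (inv \<tau> \<otimes> g)"
proof -
  have "ga_mult G (ga_basis \<tau>) y g =
      (\<Sum>h\<in>carrier G. if h = \<tau> then y (inv h \<otimes> g) else 0)"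
    unfolding ga_mult_eq[OF assms(3)] by (intro sum.cong) (auto simp: ga_basis_def)
  then show ?thesis using assms by simp
qed

lemma ga_mult_hom_left: "module_hom cfun_scale cfun_scale (ga_mult G x)"
  by unfold_locales
    (auto simp: ga_mult_def cfun_scale_def fun_eq_iff distrib_left sum.distrib sum_distrib_left ac_simps)

lemma ga_mult_hom_right: "module_hom cfun_scale cfun_scale (\<lambda>x. ga_mult G x y)"
  by unfold_locales
    (auto simp: ga_mult_def cfun_scale_def fun_eq_iff distrib_right sum.distrib sum_distrib_left ac_simps)

lemma subspace_group_algebra: "cfun.subspace (group_algebra G)"
  by (auto simp: cfun.subspace_def group_algebra_def cfun_scale_def)

text \<open>
  On the ideal, right multiplication by \<open>c\<close> is \<open>n\<close> times the identity. Hence the elements \<open>h c\<close> with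
  the functionals \<open>x \<mapsto> x(h) / n\<close> form a frame.
\<close>
lemma trace_left_ideal:
  assumes fin: "finite (carrier G)" and c: "ga_mult G c c = cfun_scale n c" and n: "n \<noteq> 0"
    and \<tau>: "\<tau> \<in> carrier G"
  shows "cfun.trace_on ((\<lambda>x. ga_mult G x c) ` group_algebra G) (ga_mult G (ga_basis \<tau>)) =
    (\<Sum>h\<in>carrier G. c (inv h \<otimes> inv \<tau> \<otimes> h)) / n"
proof -
  let ?V = "(\<lambda>x. ga_mult G x c) ` group_algebra G"
  have V_iff: "x \<in> ?V \<longleftrightarrow> x \<in> group_algebra G \<and> ga_mult G x c = cfun_scale n x" for x
  proof
    assume "x \<in> ?V"
    then show "x \<in> group_algebra G \<and> ga_mult G x c = cfun_scale n x"
      by (auto simp: ga_mult_closed ga_mult_assoc c module_hom.scale[OF ga_mult_hom_left])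
  next
    assume x: "x \<in> group_algebra G \<and> ga_mult G x c = cfun_scale n x"
    then have "ga_mult G (cfun_scale (1 / n) x) c = cfun_scale (1 / n) (cfun_scale n x)"
      by (simp add: module_hom.scale[OF ga_mult_hom_right])
    then have "x = ga_mult G (cfun_scale (1 / n) x) c"
      using n by (simp add: cfun_scale_def)
    moreover have "cfun_scale (1 / n) x \<in> group_algebra G"
      using x by (simp add: group_algebra_def cfun_scale_def)
    ultimately show "x \<in> ?V" by blast
  qed
  have V: "ga_mult G x c \<in> ?V" for x
    by (simp add: V_iff ga_mult_closed ga_mult_assoc c module_hom.scale[OF ga_mult_hom_left])
  have "cfun.trace_on ?V (ga_mult G (ga_basis \<tau>)) =
      (\<Sum>h\<in>carrier G. ga_mult G (ga_basis \<tau>) (ga_mult G (ga_basis h) c) h / n)"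
  proof (rule cfun.trace_on_frame[where \<phi> = "\<lambda>h x. x h / n"])
    show "cfun.subspace ?V"
      by (rule module_hom.subspace_image[OF ga_mult_hom_right subspace_group_algebra])
    show "module_hom cfun_scale (*) (\<lambda>x. x h / n)" for h
      by unfold_locales (auto simp: cfun_scale_def add_divide_distrib algebra_simps)
    show "module_hom cfun_scale cfun_scale (ga_mult G (ga_basis \<tau>))"
      by (rule ga_mult_hom_left)
    show "ga_mult G (ga_basis \<tau>) x \<in> ?V" if "x \<in> ?V" for x
      using that V by (auto simp flip: ga_mult_assoc)
    show "(\<Sum>h\<in>carrier G. cfun_scale (x h / n) (ga_mult G (ga_basis h) c)) = x" if "x \<in> ?V" for x
    proof (rule group_algebra_eqI)
      show "(\<Sum>h\<in>carrier G. cfun_scale (x h / n) (ga_mult G (ga_basis h) c)) \<in> group_algebra G"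
        by (intro cfun.subspace_sum[OF subspace_group_algebra]
            cfun.subspace_scale[OF subspace_group_algebra] ga_mult_closed)
      show "x \<in> group_algebra G" using that V_iff by blast
      fix g assume g: "g \<in> carrier G"
      have "(\<Sum>h\<in>carrier G. cfun_scale (x h / n) (ga_mult G (ga_basis h) c)) g =
          (\<Sum>h\<in>carrier G. x h * c (inv h \<otimes> g)) / n"
        using g fin by (simp add: sum_fun_apply cfun_scale_def ga_mult_basis_left sum_divide_distrib)
      also have "\<dots> = ga_mult G x c g / n"
        using g by (simp add: ga_mult_eq)
      also have "\<dots> = x g"
        using that V_iff n by (simp add: cfun_scale_def)
      finally show "(\<Sum>h\<in>carrier G. cfun_scale (x h / n) (ga_mult G (ga_basis h) c)) g = x g" .
    qed
  qed (use fin V in auto)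
  also have "\<dots> = (\<Sum>h\<in>carrier G. c (inv h \<otimes> inv \<tau> \<otimes> h)) / n"
    using fin \<tau> by (simp add: ga_mult_basis_left sum_divide_distrib m_assoc)
  finally show ?thesis .
qed

text \<open>
  In the character formula each \<open>h\<close> contributes \<open>c\<close> at the square of \<open>h\<inverse> \<tau>\<inverse> h\<close>. The substitution
  that replaces this element by \<open>\<tau>\<close> preserves \<open>\<epsilon>\<close>, so all \<open>h\<close> contribute equally.
\<close>
lemma signed_FS_indicator_left_ideal:
  assumes fin: "finite (carrier G)" and c: "ga_mult G c c = cfun_scale n c" and n: "n \<noteq> 0"
    and \<epsilon>_mult: "\<And>x y. x \<in> carrier G \<Longrightarrow> y \<in> carrier G \<Longrightarrow> \<epsilon> (x \<otimes> y) = \<epsilon> x * \<epsilon> y"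
    and \<epsilon>_inv: "\<And>x. x \<in> carrier G \<Longrightarrow> \<epsilon> (inv x) = \<epsilon> x"
  shows "signed_FS_indicator G \<epsilon>
      (\<lambda>\<tau>. cfun.trace_on ((\<lambda>x. ga_mult G x c) ` group_algebra G) (ga_mult G (ga_basis \<tau>))) =
    (\<Sum>\<tau>\<in>carrier G. of_int (\<epsilon> \<tau>) * c (\<tau> \<otimes> \<tau>)) / n"
proof -
  let ?S = "\<Sum>\<tau>\<in>carrier G. of_int (\<epsilon> \<tau>) * c (\<tau> \<otimes> \<tau>)"
  have conj: "(\<Sum>\<tau>\<in>carrier G. of_int (\<epsilon> \<tau>) * c (inv h \<otimes> inv (\<tau> \<otimes> \<tau>) \<otimes> h)) = ?S"
    if h: "h \<in> carrier G" for h
  proof -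
    have sq: "\<epsilon> h * \<epsilon> h = \<epsilon> \<one>"
      using \<epsilon>_mult[of h "inv h"] \<epsilon>_inv[of h] h by simp
    have one: "\<epsilon> \<one> * \<epsilon> x = \<epsilon> x" if "x \<in> carrier G" for x
      using \<epsilon>_mult[of \<one> x] that by simp
    show ?thesis
    proof (rule sum.reindex_bij_witness[where i = "\<lambda>\<tau>. h \<otimes> inv \<tau> \<otimes> inv h"
          and j = "\<lambda>\<tau>. inv h \<otimes> inv \<tau> \<otimes> h"])
      fix \<tau> assume \<tau>: "\<tau> \<in> carrier G"
      have "\<epsilon> (inv h \<otimes> inv \<tau> \<otimes> h) = (\<epsilon> h * \<epsilon> h) * \<epsilon> \<tau>"
        using h \<tau> by (simp add: \<epsilon>_mult \<epsilon>_inv)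
      then have "\<epsilon> (inv h \<otimes> inv \<tau> \<otimes> h) = \<epsilon> \<tau>"
        using \<tau> by (simp add: sq one)
      then show "of_int (\<epsilon> (inv h \<otimes> inv \<tau> \<otimes> h)) *
          c (inv h \<otimes> inv \<tau> \<otimes> h \<otimes> (inv h \<otimes> inv \<tau> \<otimes> h)) =
          of_int (\<epsilon> \<tau>) * c (inv h \<otimes> inv (\<tau> \<otimes> \<tau>) \<otimes> h)"
        using h \<tau> by (simp add: inv_mult_group m_assoc)
    qed (use h in \<open>simp_all add: inv_mult_group m_assoc\<close>)
  qed
  have "signed_FS_indicator G \<epsilon>
      (\<lambda>\<tau>. cfun.trace_on ((\<lambda>x. ga_mult G x c) ` group_algebra G) (ga_mult G (ga_basis \<tau>))) =
    (\<Sum>\<tau>\<in>carrier G. of_int (\<epsilon> \<tau>) * ((\<Sum>h\<in>carrier G. c (inv h \<otimes> inv (\<tau> \<otimes> \<tau>) \<otimes> h)) / n)) / of_nat (order G)"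
    unfolding signed_FS_indicator_def by (simp add: trace_left_ideal[OF fin c n])
  also have "\<dots> = (\<Sum>\<tau>\<in>carrier G. \<Sum>h\<in>carrier G.
      of_int (\<epsilon> \<tau>) * c (inv h \<otimes> inv (\<tau> \<otimes> \<tau>) \<otimes> h)) / n / of_nat (order G)"
    by (simp add: sum_distrib_left sum_divide_distrib)
  also have "\<dots> = (\<Sum>h\<in>carrier G. ?S) / n / of_nat (order G)"
    by (subst sum.swap) (simp add: conj)
  also have "\<dots> = ?S / n"
    using fin order_gt_0_iff_finite by (simp add: order_def)
  finally show ?thesis .
qed

end

section \<open>Counting along fibres\<close>

lemma card_fibres:
  assumes "finite X"
  shows "card {x \<in> X. P x} = (\<Sum>i\<in>\<rho> ` X. card {x \<in> X. \<rho> x = i \<and> P x})"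
proof -
  have "card {x \<in> X. P x} = (\<Sum>i\<in>\<rho> ` X. \<Sum>x | x \<in> {x \<in> X. P x} \<and> \<rho> x = i. 1)"
    unfolding card_eq_sum by (rule sum.group[symmetric]) (use assms in auto)
  also have "\<dots> = (\<Sum>i\<in>\<rho> ` X. card {x \<in> X. \<rho> x = i \<and> P x})"
    unfolding card_eq_sum by (intro sum.cong) auto
  finally show ?thesis .
qed

text \<open>Among injective labellings, the initial segment has the most labels below any bound.\<close>
lemma card_less_fibre:
  fixes h \<kappa> :: "'a \<Rightarrow> nat"
  assumes A: "finite A" and \<kappa>: "bij_betw \<kappa> A {..<card A}" and h: "inj_on h A"
  shows "card {x \<in> A. h x < m} \<le> card {x \<in> A. \<kappa> x < m}"
proof -
  have "bij_betw \<kappa> {x \<in> A. \<kappa> x < m} ({..<card A} \<inter> {..<m})"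
    using \<kappa> by (auto simp: bij_betw_def inj_on_def)
  moreover have "{..<card A} \<inter> {..<m} = {..<min (card A) m}" by auto
  ultimately have "card {x \<in> A. \<kappa> x < m} = min (card A) m"
    using bij_betw_same_card by fastforce
  moreover have "card {x \<in> A. h x < m} \<le> card A"
    using A by (intro card_mono) auto
  moreover have "card {x \<in> A. h x < m} \<le> card {..<m}"
    by (rule card_inj_on_le[where f = h]) (use h in \<open>auto simp: inj_on_def\<close>)
  ultimately show ?thesis by simp
qed

text \<open>
  The fibres of \<open>\<rho>\<close> are the rows (or the columns) of a tableau, and \<open>\<kappa>\<close> numbers each of them from
  \<open>0\<close>. Summing the previous inequality over the fibres compares \<open>\<kappa>\<close> with any labelling \<open>h\<close> that is
  injective on rows. The inequality gives the comparison of row and column lengths; the case of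
  equality, where \<open>h\<close> must itself number every row by an initial segment, is what makes the sorting
  of rows possible.
\<close>
lemma
  fixes h \<kappa> \<rho> :: "'a \<Rightarrow> nat"
  assumes X: "finite X"
    and \<kappa>: "\<And>i. bij_betw \<kappa> {x \<in> X. \<rho> x = i} {..<card {x \<in> X. \<rho> x = i}}"
    and h: "\<And>i. inj_on h {x \<in> X. \<rho> x = i}"
  shows card_less_le: "card {x \<in> X. h x < m} \<le> card {x \<in> X. \<kappa> x < m}"
    and bij_betw_fibre_of_card_eq: "(\<And>m. card {x \<in> X. h x < m} = card {x \<in> X. \<kappa> x < m}) \<Longrightarrow>
      bij_betw h {x \<in> X. \<rho> x = i} {..<card {x \<in> X. \<rho> x = i}}"
proof -
  have le: "card {x \<in> X. \<rho> x = i \<and> h x < m} \<le> card {x \<in> X. \<rho> x = i \<and> \<kappa> x < m}" for i m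
    using card_less_fibre[OF _ \<kappa> h, of i m] X by simp
  note fibres = card_fibres[OF X, of "\<lambda>x. h x < _" \<rho>] card_fibres[OF X, of "\<lambda>x. \<kappa> x < _" \<rho>]
  show "card {x \<in> X. h x < m} \<le> card {x \<in> X. \<kappa> x < m}"
    unfolding fibres by (rule sum_mono) (rule le)
  assume eq: "card {x \<in> X. h x < m} = card {x \<in> X. \<kappa> x < m}" for m
  let ?A = "{x \<in> X. \<rho> x = i}"
  show "bij_betw h ?A {..<card ?A}"
  proof (cases "i \<in> \<rho> ` X")
    case True
    have "card {x \<in> X. \<rho> x = i \<and> h x < card ?A} = card {x \<in> X. \<rho> x = i \<and> \<kappa> x < card ?A}"
      by (rule sum_mono_inv[OF eq[of "card ?A", unfolded fibres] le True finite_imageI[OF X]])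
    also have "{x \<in> X. \<rho> x = i \<and> \<kappa> x < card ?A} = ?A"
      using bij_betwE[OF \<kappa>[of i]] by blast
    finally have "{x \<in> X. \<rho> x = i \<and> h x < card ?A} = ?A"
      using X by (intro card_subset_eq) auto
    then have "h ` ?A \<subseteq> {..<card ?A}" by blast
    then have "h ` ?A = {..<card ?A}"
      using h[of i] by (intro card_subset_eq) (auto simp: card_image)
    then show ?thesis using h by (simp add: bij_betw_def)
  next
    case False
    then have empty: "?A = {}" by blast
    show ?thesis unfolding empty by (simp add: bij_betw_def)
  qed
qed

lemma card_permuted:
  assumes "p permutes X"
  shows "card {x \<in> X. P (p x)} = card {x \<in> X. P x}"
proof -
  have "bij_betw p {x \<in> X. P (p x)} {x \<in> X. P x}"
    unfolding bij_betw_def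
  proof
    show "inj_on p {x \<in> X. P (p x)}" using permutes_inj_on[OF assms] by (rule inj_on_subset) auto
    show "p ` {x \<in> X. P (p x)} = {x \<in> X. P x}"
    proof (intro subset_antisym subsetI)
      fix y assume "y \<in> {x \<in> X. P x}"
      then show "y \<in> p ` {x \<in> X. P (p x)}"
        using permutes_inverses[OF assms] permutes_in_image[OF permutes_inv[OF assms]]
        by (intro image_eqI[of _ _ "inv' p y"]) auto
    qed (use permutes_in_image[OF assms] in auto)
  qed
  then show ?thesis by (rule bij_betw_same_card)
qed

section \<open>Tableaux\<close>

definition young_subgroup :: "nat \<Rightarrow> (nat \<Rightarrow> nat) \<Rightarrow> (nat \<Rightarrow> nat) set" where
  "young_subgroup d f = {p. p permutes {1..d} \<and> (\<forall>x\<in>{1..d}. f (p x) = f x)}"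

lemma subgroup_young_subgroup: "subgroup (young_subgroup d f) (sym_group d)"
proof (rule group.subgroupI[OF sym_group_is_group])
  show "young_subgroup d f \<subseteq> carrier (sym_group d)"
    by (auto simp: young_subgroup_def sym_group_carrier)
  have "id \<in> young_subgroup d f" by (simp add: young_subgroup_def permutes_id)
  then show "young_subgroup d f \<noteq> {}" by blast
next
  fix p assume p: "p \<in> young_subgroup d f"
  then have perm: "p permutes {1..d}" by (simp add: young_subgroup_def)
  have "f (inv' p x) = f x" if "x \<in> {1..d}" for x
  proof -
    have "inv' p x \<in> {1..d}" using that permutes_in_image[OF permutes_inv[OF perm]] by blast
    then have "f (p (inv' p x)) = f (inv' p x)" using p unfolding young_subgroup_def by blast
    then show ?thesis by (simp add: permutes_inverses[OF perm])
  qed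
  then have "inv' p \<in> young_subgroup d f"
    using permutes_inv[OF perm] by (simp add: young_subgroup_def)
  then show "inv\<^bsub>sym_group d\<^esub> p \<in> young_subgroup d f"
    using perm by (simp add: sym_group_carrier)
next
  fix p q assume p: "p \<in> young_subgroup d f" and q: "q \<in> young_subgroup d f"
  have "f (p (q x)) = f x" if "x \<in> {1..d}" for x
    using p q that permutes_in_image[of q "{1..d}" x] unfolding young_subgroup_def by auto
  then have "p \<circ> q \<in> young_subgroup d f"
    using p q by (auto simp: young_subgroup_def intro: permutes_compose)
  then show "p \<otimes>\<^bsub>sym_group d\<^esub> q \<in> young_subgroup d f" by (simp add: sym_group_mult)
qed

lemma transpose_in_young_subgroup:
  "x \<in> {1..d} \<Longrightarrow> y \<in> {1..d} \<Longrightarrow> f x = f y \<Longrightarrow> transpose x y \<in> young_subgroup d f"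
  by (auto simp: young_subgroup_def permutes_swap_id transpose_def)

lemma conjugate_transposition:
  assumes p: "p permutes {1..d}" and xy: "x \<in> {1..d}" "y \<in> {1..d}" "x \<noteq> y" "f x = f y"
    and f': "f' (inv' p x) = f' (inv' p y)"
  shows "\<exists>s\<in>young_subgroup d f. sign s = - 1 \<and>
    inv\<^bsub>sym_group d\<^esub> p \<otimes>\<^bsub>sym_group d\<^esub> s \<otimes>\<^bsub>sym_group d\<^esub> p \<in> young_subgroup d f'"
proof -
  let ?s' = "transpose (inv' p x) (inv' p y)"
  have "inv' p \<circ> transpose x y \<circ> p = inv' p \<circ> (p \<circ> ?s')"
    using transpose_comp_eq[OF permutes_bij[OF p], of x y] by (simp add: comp_assoc)
  also have "\<dots> = ?s'"
    by (simp add: permutes_inv_o[OF p] flip: comp_assoc)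
  finally have "inv' p \<circ> transpose x y \<circ> p = ?s'" .
  moreover have "?s' \<in> young_subgroup d f'"
    using f' xy permutes_in_image[OF permutes_inv[OF p]] by (intro transpose_in_young_subgroup) auto
  ultimately show ?thesis
    using xy p by (intro bexI[of _ "transpose x y"] transpose_in_young_subgroup)
      (simp_all add: sign_swap_id sym_group_mult sym_group_carrier)
qed

text \<open>
  A tableau with entries \<open>1, \<dots>, d\<close> is given by the row \<open>rw x\<close> and the column \<open>cl x\<close> of each entry;
  the assumptions say that every row and every column is a contiguous segment starting at \<open>0\<close>.
\<close>
locale tableau =
  fixes d :: nat and rw cl :: "nat \<Rightarrow> nat"
  assumes cl_bij: "\<And>i. bij_betw cl {x \<in> {1..d}. rw x = i} {..<card {x \<in> {1..d}. rw x = i}}"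
    and rw_bij: "\<And>j. bij_betw rw {x \<in> {1..d}. cl x = j} {..<card {x \<in> {1..d}. cl x = j}}"
begin

lemma position_inj:
  assumes "x \<in> {1..d}" "y \<in> {1..d}" "rw x = rw y" "cl x = cl y"
  shows "x = y"
  using bij_betw_imp_inj_on[OF cl_bij[of "rw y"]] assms unfolding inj_on_def by blast

text \<open>
  The combinatorial heart of Young's theory. If entries of one row never come from one column under
  \<open>g\<close>, then \<open>h x\<close>, the column from which \<open>g\<close> brings \<open>x\<close>, is injective on rows. It has as
  many values below each bound as \<open>cl\<close>, so it numbers every row by an initial segment. Sorting
  each row by \<open>h\<close> then gives \<open>p\<close> in the row group such that \<open>p\<inverse> g\<close> preserves columns.
\<close>
lemma row_column_collision:
  assumes g: "g permutes {1..d}" and no: "\<forall>p\<in>young_subgroup d rw. inv' p \<circ> g \<notin> young_subgroup d cl"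
  shows "\<exists>x\<in>{1..d}. \<exists>y\<in>{1..d}. x \<noteq> y \<and> rw x = rw y \<and> cl (inv' g x) = cl (inv' g y)"
proof (rule ccontr)
  assume not: "\<not> ?thesis"
  define h where "h = cl \<circ> inv' g"
  let ?row = "\<lambda>x. {y \<in> {1..d}. rw y = rw x}"
  have h_inj: "inj_on h {x \<in> {1..d}. rw x = i}" for i
    unfolding inj_on_def h_def comp_def using not by blast
  have "card {x \<in> {1..d}. h x < m} = card {x \<in> {1..d}. cl x < m}" for m
    using card_permuted[OF permutes_inv[OF g], of "\<lambda>x. cl x < m"] by (simp add: h_def)
  then have h_bij: "bij_betw h {x \<in> {1..d}. rw x = i} {..<card {x \<in> {1..d}. rw x = i}}" for i
    by (intro bij_betw_fibre_of_card_eq[OF _ cl_bij h_inj]) auto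
  \<comment> \<open>\<open>p\<close> moves \<open>x\<close> to the entry of its row that \<open>g\<close> brings from the column of \<open>x\<close>.\<close>
  define p where "p x = (if x \<in> {1..d} then inv_into (?row x) h (cl x) else x)" for x
  have p: "p x \<in> {1..d} \<and> rw (p x) = rw x \<and> h (p x) = cl x" if x: "x \<in> {1..d}" for x
  proof -
    have "cl x \<in> cl ` ?row x" using x by blast
    also have "cl ` ?row x = h ` ?row x"
      using cl_bij[of "rw x"] h_bij[of "rw x"] by (simp add: bij_betw_def)
    finally have "cl x \<in> h ` ?row x" .
    from inv_into_into[OF this] f_inv_into_f[OF this] show ?thesis
      using x by (simp add: p_def)
  qed
  have "inj_on p {1..d}"
    using p position_inj unfolding inj_on_def by metis
  then have "p permutes {1..d}"
    using p by (intro inj_imp_permutes) (auto simp: p_def)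
  then have pR: "p \<in> young_subgroup d rw"
    using p by (simp add: young_subgroup_def)
  have q_perm: "inv' g \<circ> p permutes {1..d}"
    using permutes_compose[OF \<open>p permutes _\<close> permutes_inv[OF g]] .
  then have "inv' g \<circ> p \<in> young_subgroup d cl"
    using p by (simp add: young_subgroup_def h_def)
  from subgroup.m_inv_closed[OF subgroup_young_subgroup this] q_perm
  have "inv' (inv' g \<circ> p) \<in> young_subgroup d cl" by (simp add: sym_group_carrier)
  also have "inv' (inv' g \<circ> p) = inv' p \<circ> g"
    using o_inv_distrib[OF permutes_bij[OF permutes_inv[OF g]] permutes_bij[OF \<open>p permutes _\<close>]]
      permutes_inv_inv[OF g] by simp
  finally show False using no pR by blast
qed

lemma young_pair_sym_group: "young_pair (sym_group d) sign (young_subgroup d rw) (young_subgroup d cl)"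
proof -
  interpret group "sym_group d" by (rule sym_group_is_group)
  show ?thesis
  proof (intro young_pair.intro young_pair_axioms.intro sym_group_is_group subgroup_young_subgroup)
    show "finite (carrier (sym_group d))"
      by (simp add: sym_group_def finite_permutations)
    show "sign (x \<otimes>\<^bsub>sym_group d\<^esub> y) = sign x * sign y"
      if "x \<in> carrier (sym_group d)" "y \<in> carrier (sym_group d)" for x y
      using that by (simp add: sym_group_mult sign_compose sym_group_carrier')
    show "sign x = 1 \<or> sign x = - 1" for x :: "nat \<Rightarrow> nat" by (cases x rule: sign_cases) auto
    have "p = id" if p: "p \<in> young_subgroup d rw" "p \<in> young_subgroup d cl" for p
    proof
      fix x
      have perm: "p permutes {1..d}" using p by (simp add: young_subgroup_def)
      show "p x = id x"
      proof (cases "x \<in> {1..d}")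
        case True
        then have "p x \<in> {1..d}" by (simp only: permutes_in_image[OF perm])
        moreover have "rw (p x) = rw x" "cl (p x) = cl x"
          using True p unfolding young_subgroup_def by blast+
        ultimately show ?thesis using True position_inj[of "p x" x] by simp
      qed (simp add: permutes_not_in[OF perm])
    qed
    then show "young_subgroup d rw \<inter> young_subgroup d cl = {\<one>\<^bsub>sym_group d\<^esub>}"
      by (auto simp: sym_group_one young_subgroup_def permutes_id)
    fix g assume g: "g \<in> carrier (sym_group d)"
      and no: "\<forall>p\<in>young_subgroup d rw. inv\<^bsub>sym_group d\<^esub> p \<otimes>\<^bsub>sym_group d\<^esub> g \<notin> young_subgroup d cl"
    have "\<forall>p\<in>young_subgroup d rw. inv' p \<circ> g \<notin> young_subgroup d cl"
      using no subgroup.mem_carrier[OF subgroup_young_subgroup] by (simp add: sym_group_mult)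
    with row_column_collision[of g] g
    show "\<exists>s\<in>young_subgroup d rw. sign s = - 1 \<and>
        inv\<^bsub>sym_group d\<^esub> g \<otimes>\<^bsub>sym_group d\<^esub> s \<otimes>\<^bsub>sym_group d\<^esub> g \<in> young_subgroup d cl"
      unfolding sym_group_carrier by (meson conjugate_transposition)
  qed
qed

text \<open>
  If both alternatives fail, then \<open>rw \<circ> k\<inverse>\<close> is injective on rows and \<open>cl \<circ> k\<close> is injective on
  columns. The two resulting inequalities show that the first \<open>m\<close> rows and the first \<open>m\<close> columns
  contain equally many entries.
\<close>
lemma odd_conjugate_in_same_subgroup:
  assumes k: "k permutes {1..d}"
    and m: "card {x \<in> {1..d}. rw x < m} \<noteq> card {x \<in> {1..d}. cl x < m}"
  shows "(\<exists>s\<in>young_subgroup d rw. sign s = - 1 \<and>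
        inv\<^bsub>sym_group d\<^esub> k \<otimes>\<^bsub>sym_group d\<^esub> s \<otimes>\<^bsub>sym_group d\<^esub> k \<in> young_subgroup d rw) \<or>
      (\<exists>s\<in>young_subgroup d cl. sign s = - 1 \<and>
        k \<otimes>\<^bsub>sym_group d\<^esub> s \<otimes>\<^bsub>sym_group d\<^esub> inv\<^bsub>sym_group d\<^esub> k \<in> young_subgroup d cl)"
proof (rule ccontr)
  assume not: "\<not> ?thesis"
  have k': "inv' k permutes {1..d}" using k by (rule permutes_inv)
  have row: "inj_on (rw \<circ> inv' k) {x \<in> {1..d}. rw x = i}" for i
    unfolding inj_on_def comp_def using not conjugate_transposition[OF k, of _ _ rw rw] by blast
  have col: "inj_on (cl \<circ> k) {x \<in> {1..d}. cl x = j}" for j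
  proof -
    interpret group "sym_group d" by (rule sym_group_is_group)
    have "inv\<^bsub>sym_group d\<^esub> (inv' k) = k"
      using k k' permutes_inv_inv[OF k] by (simp add: sym_group_carrier)
    moreover have "inv\<^bsub>sym_group d\<^esub> k = inv' k" using k by (simp add: sym_group_carrier)
    ultimately have "\<exists>s\<in>young_subgroup d cl. sign s = - 1 \<and>
        k \<otimes>\<^bsub>sym_group d\<^esub> s \<otimes>\<^bsub>sym_group d\<^esub> inv\<^bsub>sym_group d\<^esub> k \<in> young_subgroup d cl"
      if "x \<in> {1..d}" "y \<in> {1..d}" "x \<noteq> y" "cl x = cl y" "cl (k x) = cl (k y)" for x y
      using conjugate_transposition[OF k' that(1-4), of cl] that(5) permutes_inv_inv[OF k] by simp
    then show ?thesis
      unfolding inj_on_def comp_def using not by blast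
  qed
  have "card {x \<in> {1..d}. rw x < m} \<le> card {x \<in> {1..d}. cl x < m}"
    using card_less_le[OF _ cl_bij row, of m] card_permuted[OF k', of "\<lambda>x. rw x < m"] by simp
  moreover have "card {x \<in> {1..d}. cl x < m} \<le> card {x \<in> {1..d}. rw x < m}"
    using card_less_le[OF _ rw_bij col, of m] card_permuted[OF k, of "\<lambda>x. cl x < m"] by simp
  ultimately show False using m by simp
qed

end

section \<open>The row-by-row tableau of a partition\<close>

lemma down_closed_eq_lessThan:
  fixes S :: "nat set"
  assumes fin: "finite S" and down: "\<And>x y. x \<in> S \<Longrightarrow> y \<le> x \<Longrightarrow> y \<in> S"
  shows "S = {..<card S}"
proof (rule card_subset_eq[symmetric, OF fin])
  show "{..<card S} \<subseteq> S"
  proof (rule ccontr)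
    assume "\<not> {..<card S} \<subseteq> S"
    then obtain n where n: "n < card S" "n \<notin> S" by blast
    then have "S \<subseteq> {..<n}" using down by (metis lessThan_iff linorder_not_le subsetI)
    then have "card S \<le> n" using card_mono[of "{..<n}" S] by simp
    then show False using n by simp
  qed
qed simp

lemma bij_betw_row_tableau: 
  assumes "sum_list \<mu> = d"
  shows "bij_betw (row_tableau \<mu>) (young_diagram \<mu>) {1..d}"
proof -
  have step: "sum_list (take i \<mu>) + j < sum_list (take (Suc i) \<mu>)" if "(i, j) \<in> young_diagram \<mu>" for i j
    using that by (simp add: young_diagram_def take_Suc_conv_app_nth)
  have mono: "sum_list (take i \<mu>) \<le> sum_list (take k \<mu>)" if "i \<le> k" for i k
  proof -
    have "take k \<mu> = take i \<mu> @ drop i (take k \<mu>)"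
      using that by (metis append_take_drop_id min.absorb1 take_take)
    then show ?thesis by (metis le_add1 sum_list_append)
  qed
  have less: "row_tableau \<mu> (i, j) < row_tableau \<mu> (k, l)"
    if "(i, j) \<in> young_diagram \<mu>" "i < k" for i j k l
    using step[OF that(1)] mono[of "Suc i" k] that(2) by (simp add: row_tableau_def)
  have inj: "inj_on (row_tableau \<mu>) (young_diagram \<mu>)"
  proof (rule inj_onI, clarify)
    fix i j k l assume *: "(i, j) \<in> young_diagram \<mu>" "(k, l) \<in> young_diagram \<mu>"
      "row_tableau \<mu> (i, j) = row_tableau \<mu> (k, l)"
    then have "i = k" using less[of i j k l] less[of k l i j] by (metis less_irrefl linorder_neqE_nat)
    then show "i = k \<and> j = l" using * by (simp add: row_tableau_def)
  qed
  have "row_tableau \<mu> ` young_diagram \<mu> \<subseteq> {1..d}"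
  proof clarify
    fix i j assume "(i, j) \<in> young_diagram \<mu>"
    then have "sum_list (take i \<mu>) + j < sum_list (take (length \<mu>) \<mu>)" "i < length \<mu>"
      using step[of i j] mono[of "Suc i" "length \<mu>"] by (auto simp: young_diagram_def)
    then show "row_tableau \<mu> (i, j) \<in> {1..d}" using assms by (simp add: row_tableau_def)
  qed
  moreover have "card (row_tableau \<mu> ` young_diagram \<mu>) = card {1..d}"
    using inj assms by (simp add: card_image card_young_diagram)
  ultimately have "row_tableau \<mu> ` young_diagram \<mu> = {1..d}"
    by (intro card_subset_eq) auto
  with inj show ?thesis by (simp add: bij_betw_def)
qed

definition cell :: "nat list \<Rightarrow> nat \<Rightarrow> nat \<times> nat" where
  "cell \<mu> = inv_into (young_diagram \<mu>) (row_tableau \<mu>)"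

definition row_of :: "nat list \<Rightarrow> nat \<Rightarrow> nat" where
  "row_of \<mu> x = fst (cell \<mu> x)"

definition column_of :: "nat list \<Rightarrow> nat \<Rightarrow> nat" where
  "column_of \<mu> x = snd (cell \<mu> x)"

context
  fixes d :: nat and \<mu> :: "nat list"
  assumes \<mu>: "is_partition d \<mu>"
begin

lemma row_tableau_bij: "bij_betw (row_tableau \<mu>) (young_diagram \<mu>) {1..d}"
  using \<mu> unfolding is_partition_def by (blast intro: bij_betw_row_tableau)

lemma cell_bij: "bij_betw (cell \<mu>) {1..d} (young_diagram \<mu>)"
  unfolding cell_def by (rule bij_betw_inv_into[OF row_tableau_bij])

lemma cell_row_tableau: "c \<in> young_diagram \<mu> \<Longrightarrow> cell \<mu> (row_tableau \<mu> c) = c"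
  unfolding cell_def by (rule bij_betw_inv_into_left[OF row_tableau_bij])

lemma row_tableau_cell: "x \<in> {1..d} \<Longrightarrow> row_tableau \<mu> (cell \<mu> x) = x"
  unfolding cell_def by (rule bij_betw_inv_into_right[OF row_tableau_bij])

lemma cell_in: "x \<in> {1..d} \<Longrightarrow> cell \<mu> x \<in> young_diagram \<mu>"
  by (rule bij_betwE[OF cell_bij, rule_format])

lemma row_tableau_in: "c \<in> young_diagram \<mu> \<Longrightarrow> row_tableau \<mu> c \<in> {1..d}"
  by (rule bij_betwE[OF row_tableau_bij, rule_format])

lemma cell_bij_restrict: "bij_betw (cell \<mu>) {x \<in> {1..d}. P (cell \<mu> x)} {c \<in> young_diagram \<mu>. P c}"
proof (rule bij_betw_subset[OF cell_bij])
  show "cell \<mu> ` {x \<in> {1..d}. P (cell \<mu> x)} = {c \<in> young_diagram \<mu>. P c}"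
  proof (intro subset_antisym subsetI)
    fix c assume "c \<in> {c \<in> young_diagram \<mu>. P c}"
    then show "c \<in> cell \<mu> ` {x \<in> {1..d}. P (cell \<mu> x)}"
      using cell_row_tableau row_tableau_in by (intro image_eqI[of _ _ "row_tableau \<mu> c"]) auto
  qed (use cell_in in auto)
qed auto

lemma card_cell_restrict: "card {x \<in> {1..d}. P (cell \<mu> x)} = card {c \<in> young_diagram \<mu>. P c}"
  by (rule bij_betw_same_card[OF cell_bij_restrict])

lemma young_diagram_down:
  assumes "(i, j) \<in> young_diagram \<mu>" "i' \<le> i" "j' \<le> j"
  shows "(i', j') \<in> young_diagram \<mu>"
  using assms partition_antimono[OF \<mu>, of i' i] by (auto simp: young_diagram_def)

lemma tableau_row_column: "tableau d (row_of \<mu>) (column_of \<mu>)"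
proof
  let ?Y = "young_diagram \<mu>"
  have fibre: "bij_betw (\<lambda>x. f (cell \<mu> x)) {x \<in> {1..d}. g (cell \<mu> x) = i} {..<card {x \<in> {1..d}. g (cell \<mu> x) = i}}"
    if fg: "inj_on f {c \<in> ?Y. g c = i}"
      and down: "\<And>x y. x \<in> f ` {c \<in> ?Y. g c = i} \<Longrightarrow> y \<le> x \<Longrightarrow> y \<in> f ` {c \<in> ?Y. g c = i}"
    for f g :: "nat \<times> nat \<Rightarrow> nat" and i
  proof -
    have "bij_betw f {c \<in> ?Y. g c = i} (f ` {c \<in> ?Y. g c = i})"
      using fg by (rule inj_on_imp_bij_betw)
    also have "f ` {c \<in> ?Y. g c = i} = {..<card (f ` {c \<in> ?Y. g c = i})}"
      by (rule down_closed_eq_lessThan[OF _ down]) (auto simp: finite_young_diagram)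
    also have "card (f ` {c \<in> ?Y. g c = i}) = card {x \<in> {1..d}. g (cell \<mu> x) = i}"
      using card_image[OF fg] card_cell_restrict[of "\<lambda>c. g c = i"] by simp
    finally have "bij_betw f {c \<in> ?Y. g c = i} {..<card {x \<in> {1..d}. g (cell \<mu> x) = i}}" .
    from bij_betw_trans[OF cell_bij_restrict this] show ?thesis by (simp add: comp_def)
  qed
  show "bij_betw (column_of \<mu>) {x \<in> {1..d}. row_of \<mu> x = i} {..<card {x \<in> {1..d}. row_of \<mu> x = i}}" for i
    unfolding column_of_def row_of_def
  proof (rule fibre)
    fix x y assume "x \<in> snd ` {c \<in> ?Y. fst c = i}" "y \<le> x"
    then have "(i, y) \<in> ?Y" using young_diagram_down by auto
    then show "y \<in> snd ` {c \<in> ?Y. fst c = i}" by (intro image_eqI[of _ _ "(i, y)"]) auto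
  qed (auto simp: inj_on_def)
  show "bij_betw (row_of \<mu>) {x \<in> {1..d}. column_of \<mu> x = j} {..<card {x \<in> {1..d}. column_of \<mu> x = j}}" for j
    unfolding column_of_def row_of_def
  proof (rule fibre)
    fix x y assume "x \<in> fst ` {c \<in> ?Y. snd c = j}" "y \<le> x"
    then have "(y, j) \<in> ?Y" using young_diagram_down by auto
    then show "y \<in> fst ` {c \<in> ?Y. snd c = j}" by (intro image_eqI[of _ _ "(y, j)"]) auto
  qed (auto simp: inj_on_def)
qed

lemma row_group_eq: "row_group d \<mu> = young_subgroup d (row_of \<mu>)"
proof (intro Set.set_eqI iffI)
  fix p assume p: "p \<in> row_group d \<mu>"
  have "row_of \<mu> (p x) = row_of \<mu> x" if x: "x \<in> {1..d}" for x
  proof -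
    obtain i j where c: "cell \<mu> x = (i, j)" by fastforce
    then have "(i, j) \<in> young_diagram \<mu>" using cell_in[OF x] by simp
    then obtain j' where "(i, j') \<in> young_diagram \<mu>" "p (row_tableau \<mu> (i, j)) = row_tableau \<mu> (i, j')"
      using p unfolding row_group_def by blast
    then show ?thesis
      using row_tableau_cell[OF x] cell_row_tableau[of "(i, j')"] c by (simp add: row_of_def)
  qed
  then show "p \<in> young_subgroup d (row_of \<mu>)"
    using p by (simp add: young_subgroup_def row_group_def sym_group_carrier)
next
  fix p assume p: "p \<in> young_subgroup d (row_of \<mu>)"
  then have perm: "p permutes {1..d}" by (simp add: young_subgroup_def)
  have "\<exists>j'. (i, j') \<in> young_diagram \<mu> \<and> p (row_tableau \<mu> (i, j)) = row_tableau \<mu> (i, j')"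
    if ij: "(i, j) \<in> young_diagram \<mu>" for i j
  proof -
    let ?x = "row_tableau \<mu> (i, j)"
    have x: "?x \<in> {1..d}" and px: "p ?x \<in> {1..d}"
      using row_tableau_in[OF ij] permutes_in_image[OF perm] by blast+
    have "fst (cell \<mu> (p ?x)) = i"
      using p x cell_row_tableau[OF ij] unfolding young_subgroup_def row_of_def by fastforce
    then have "cell \<mu> (p ?x) = (i, snd (cell \<mu> (p ?x)))" by (simp add: prod_eq_iff)
    then show ?thesis using cell_in[OF px] row_tableau_cell[OF px] by metis
  qed
  then show "p \<in> row_group d \<mu>"
    using perm by (auto simp: row_group_def sym_group_carrier)
qed

lemma column_group_eq: "column_group d \<mu> = young_subgroup d (column_of \<mu>)"
proof (intro Set.set_eqI iffI)
  fix p assume p: "p \<in> column_group d \<mu>"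
  have "column_of \<mu> (p x) = column_of \<mu> x" if x: "x \<in> {1..d}" for x
  proof -
    obtain i j where c: "cell \<mu> x = (i, j)" by fastforce
    then have "(i, j) \<in> young_diagram \<mu>" using cell_in[OF x] by simp
    then obtain i' where "(i', j) \<in> young_diagram \<mu>" "p (row_tableau \<mu> (i, j)) = row_tableau \<mu> (i', j)"
      using p unfolding column_group_def by blast
    then show ?thesis
      using row_tableau_cell[OF x] cell_row_tableau[of "(i', j)"] c by (simp add: column_of_def)
  qed
  then show "p \<in> young_subgroup d (column_of \<mu>)"
    using p by (simp add: young_subgroup_def column_group_def sym_group_carrier)
next
  fix p assume p: "p \<in> young_subgroup d (column_of \<mu>)"
  then have perm: "p permutes {1..d}" by (simp add: young_subgroup_def)
  have "\<exists>i'. (i', j) \<in> young_diagram \<mu> \<and> p (row_tableau \<mu> (i, j)) = row_tableau \<mu> (i', j)"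
    if ij: "(i, j) \<in> young_diagram \<mu>" for i j
  proof -
    let ?x = "row_tableau \<mu> (i, j)"
    have x: "?x \<in> {1..d}" and px: "p ?x \<in> {1..d}"
      using row_tableau_in[OF ij] permutes_in_image[OF perm] by blast+
    have "snd (cell \<mu> (p ?x)) = j"
      using p x cell_row_tableau[OF ij] unfolding young_subgroup_def column_of_def by fastforce
    then have "cell \<mu> (p ?x) = (fst (cell \<mu> (p ?x)), j)" by (simp add: prod_eq_iff)
    then show ?thesis using cell_in[OF px] row_tableau_cell[OF px] by metis
  qed
  then show "p \<in> column_group d \<mu>"
    using perm by (auto simp: column_group_def sym_group_carrier)
qed

end

lemma partition_eqI:
  assumes \<mu>: "is_partition d \<mu>" and \<nu>: "is_partition d' \<nu>"
    and eq: "\<And>m. card {c \<in> young_diagram \<mu>. fst c < m} = card {c \<in> young_diagram \<nu>. fst c < m}"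
  shows "\<mu> = \<nu>"
proof -
  define part where "part \<kappa> i = (if i < length \<kappa> then \<kappa> ! i else 0)" for \<kappa> :: "nat list" and i
  have row: "card {c \<in> young_diagram \<kappa>. fst c < Suc i} = card {c \<in> young_diagram \<kappa>. fst c < i} + part \<kappa> i"
    for \<kappa> i
  proof -
    have "{c \<in> young_diagram \<kappa>. fst c < Suc i} =
        {c \<in> young_diagram \<kappa>. fst c < i} \<union> Pair i ` {..<part \<kappa> i}"
      by (auto simp: young_diagram_def part_def less_Suc_eq)
    moreover have "{c \<in> young_diagram \<kappa>. fst c < i} \<inter> Pair i ` {..<part \<kappa> i} = {}" by auto
    ultimately show ?thesis
      by (simp add: card_Un_disjoint finite_young_diagram card_image inj_on_def)
  qed
  have part: "part \<mu> i = part \<nu> i" for i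
    using row[of \<mu> i] row[of \<nu> i] eq by simp
  have pos: "i < length \<kappa> \<longleftrightarrow> part \<kappa> i \<noteq> 0" if "is_partition n \<kappa>" for \<kappa> n i
    using that by (auto simp: part_def is_partition_def in_set_conv_nth)
  have "i < length \<mu> \<longleftrightarrow> i < length \<nu>" for i
    by (simp add: pos[OF \<mu>] pos[OF \<nu>] part)
  then have "length \<mu> = length \<nu>" by (metis linorder_neqE_nat less_irrefl)
  then show ?thesis
  proof (rule nth_equalityI)
    fix i assume "i < length \<mu>"
    then show "\<mu> ! i = \<nu> ! i"
      using part[of i] \<open>length \<mu> = length \<nu>\<close> by (simp add: part_def)
  qed
qed

text \<open>A partition is determined by the sizes of its first \<open>m\<close> rows, and the first \<open>m\<close> rows of the
  conjugate are the first \<open>m\<close> columns.\<close>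
lemma conj_partition_eqI:
  assumes \<mu>: "is_partition d \<mu>"
    and eq: "\<And>m. card {x \<in> {1..d}. row_of \<mu> x < m} = card {x \<in> {1..d}. column_of \<mu> x < m}"
  shows "conj_partition \<mu> = \<mu>"
proof (rule partition_eqI[OF is_partition_conj[OF \<mu>] \<mu>])
  fix m
  have "card {c \<in> young_diagram (conj_partition \<mu>). fst c < m} =
      card (prod.swap ` {c \<in> young_diagram \<mu>. snd c < m})"
    unfolding young_diagram_conj[OF \<mu>] by (intro arg_cong[where f = card]) auto
  also have "\<dots> = card {c \<in> young_diagram \<mu>. snd c < m}"
    by (simp add: card_image)
  also have "\<dots> = card {c \<in> young_diagram \<mu>. fst c < m}"
    using eq[of m] card_cell_restrict[OF \<mu>, of "\<lambda>c. fst c < m"] card_cell_restrict[OF \<mu>, of "\<lambda>c. snd c < m"]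
    by (simp add: row_of_def column_of_def)
  finally show "card {c \<in> young_diagram (conj_partition \<mu>). fst c < m} =
      card {c \<in> young_diagram \<mu>. fst c < m}" .
qed

section \<open>The indicator of a Specht module\<close>

text \<open>Composing with the transposition of \<open>x\<close> and \<open>t x\<close> makes these two points fixed, and
  leaves an involution.\<close>
lemma sign_involution:
  assumes "finite X" "t permutes X" "t \<circ> t = id"
  shows "sign t = (- 1) ^ (card {x \<in> X. t x \<noteq> x} div 2)"
  using assms(2,3)
proof (induction "card {x \<in> X. t x \<noteq> x}" arbitrary: t rule: less_induct)
  case less
  have inv: "t (t x) = x" for x using less.prems(2) by (metis comp_apply id_apply)
  show ?case
  proof (cases "\<exists>x\<in>X. t x \<noteq> x")
    case False
    have "t = id"
    proof
      show "t x = id x" for x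
        using False permutes_not_in[OF less.prems(1)] by (cases "x \<in> X") auto
    qed
    then show ?thesis by simp
  next
    case True
    then obtain x where x: "x \<in> X" "t x \<noteq> x" by blast
    then have tx: "t x \<in> X" using permutes_in_image[OF less.prems(1)] by simp
    define s where "s = transpose x (t x)"
    define u where "u = s \<circ> t"
    have u_apply: "u y = (if y = x \<or> y = t x then y else t y)" for y
    proof (cases "y = x \<or> y = t x")
      case True
      then show ?thesis using inv[of x] by (auto simp: u_def s_def)
    next
      case False
      then have "t y \<noteq> x" "t y \<noteq> t x" using inv by metis+
      then show ?thesis using False by (simp add: u_def s_def)
    qed
    have u_perm: "u permutes X"
      unfolding u_def s_def by (rule permutes_compose[OF less.prems(1) permutes_swap_id[OF x(1) tx]])
    have u_inv: "u \<circ> u = id"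
    proof
      fix y
      show "(u \<circ> u) y = id y"
      proof (cases "y = x \<or> y = t x")
        case True
        then show ?thesis by (auto simp: u_apply)
      next
        case False
        then have "t y \<noteq> x" "t y \<noteq> t x" using inv by metis+
        then show ?thesis using False inv by (simp add: u_apply)
      qed
    qed
    have moved: "{y \<in> X. t y \<noteq> y} = insert x (insert (t x) {y \<in> X. u y \<noteq> y})"
      using x tx by (auto simp: u_apply inv)
    have card: "card {y \<in> X. t y \<noteq> y} = Suc (Suc (card {y \<in> X. u y \<noteq> y}))"
      unfolding moved using x assms(1) by (simp add: u_apply)
    have "sign t = sign (s \<circ> u)"
      by (simp add: u_def s_def flip: comp_assoc)
    also have "\<dots> = sign s * sign u"
      using permutation_permutes assms(1) u_perm unfolding s_def
      by (intro sign_compose permutation_swap_id) blast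
    also have "sign s = - 1" using x(2) by (simp add: s_def sign_swap_id)
    also have "sign u = (- 1) ^ (card {y \<in> X. u y \<noteq> y} div 2)"
      by (rule less.hyps[OF _ u_perm u_inv]) (simp add: card)
    finally show ?thesis by (simp add: card)
  qed
qed

text \<open>This carries the integral symmetrizer of the abstract setting over to the complex one, so
  that the identities proved there apply to the Specht module.\<close>
lemma young_symmetrizer_eq:
  assumes "is_partition d \<mu>"
  defines "c \<equiv> young_pair.symmetrizer (sym_group d) sign (row_group d \<mu>) (column_group d \<mu>)"
  assumes g: "g \<in> carrier (sym_group d)"
  shows "young_symmetrizer d \<mu> g = of_int (c g)"
proof -
  interpret young_pair "sym_group d" sign "row_group d \<mu>" "column_group d \<mu>"
    unfolding row_group_eq[OF assms(1)] column_group_eq[OF assms(1)]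
    by (rule tableau.young_pair_sym_group[OF tableau_row_column[OF assms(1)]])
  have fin: "finite (row_group d \<mu>)" "finite (column_group d \<mu>)"
    using finite_R finite_subset[OF subgroup.subset[OF C] finite_G] by auto
  have row: "row_symmetrizer d \<mu> h = (if h \<in> row_group d \<mu> then 1 else 0)" for h
    using fin by (simp add: row_symmetrizer_def sum_fun_apply ga_basis_def)
  have col: "column_antisymmetrizer d \<mu> h = of_int (col_sign h)" for h
    using fin by (simp add: column_antisymmetrizer_def sum_fun_apply ga_basis_def cfun_scale_def col_sign_def
        if_distrib[of "(*) _"] cong: if_cong)
  have "young_symmetrizer d \<mu> g = (\<Sum>h\<in>carrier (sym_group d).
      if h \<in> row_group d \<mu> then of_int (col_sign (inv\<^bsub>sym_group d\<^esub> h \<otimes>\<^bsub>sym_group d\<^esub> g)) else 0)"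
    unfolding young_symmetrizer_def ga_mult_eq[OF g] by (intro sum.cong) (simp_all add: row col)
  also have "\<dots> = (\<Sum>h\<in>row_group d \<mu>. of_int (col_sign (inv\<^bsub>sym_group d\<^esub> h \<otimes>\<^bsub>sym_group d\<^esub> g)))"
    using finite_G subgroup.subset[OF R] by (intro sum.mono_neutral_cong_right) auto
  finally show ?thesis by (simp add: c_def symmetrizer_def)
qed

theorem proposition9:
  fixes d :: nat and \<mu> :: "nat list"
  assumes "is_partition d \<mu>"
  shows "SFS d \<mu> =
    (if conj_partition \<mu> = \<mu> then (- 1) ^ ((d - diag_length \<mu>) div 2) else 0)"
proof -
  note \<mu> = assms
  let ?G = "sym_group d" and ?rw = "row_of \<mu>" and ?cl = "column_of \<mu>" and ?c = "young_symmetrizer d \<mu>"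
  interpret T: tableau d ?rw ?cl by (rule tableau_row_column[OF \<mu>])
  interpret young_pair ?G sign "row_group d \<mu>" "column_group d \<mu>"
    unfolding row_group_eq[OF \<mu>] column_group_eq[OF \<mu>] by (rule T.young_pair_sym_group)
  let ?n = "sandwich_scalar \<one>\<^bsub>?G\<^esub>"
  have cc: "ga_mult ?G ?c ?c = cfun_scale (of_int ?n) ?c"
  proof (rule group_algebra_eqI)
    show "cfun_scale (of_int ?n) ?c \<in> group_algebra ?G"
      unfolding young_symmetrizer_def
      by (intro cfun.subspace_scale[OF subspace_group_algebra] ga_mult_closed)
    fix g assume g: "g \<in> carrier ?G"
    have "ga_mult ?G ?c ?c g = of_int (\<Sum>w\<in>carrier ?G. symmetrizer w * symmetrizer (inv\<^bsub>?G\<^esub> w \<otimes>\<^bsub>?G\<^esub> g))"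
      using g by (simp add: ga_mult_eq young_symmetrizer_eq[OF \<mu>] del: sym_group_inv_equality)
    then show "ga_mult ?G ?c ?c g = cfun_scale (of_int ?n) ?c g"
      using g by (simp add: symmetrizer_convolve cfun_scale_def young_symmetrizer_eq[OF \<mu>] del: sym_group_inv_equality)
  qed (rule ga_mult_closed)
  have "SFS d \<mu> = (\<Sum>\<tau>\<in>carrier ?G. of_int (sign \<tau>) * ?c (\<tau> \<otimes>\<^bsub>?G\<^esub> \<tau>)) / of_int ?n"
    unfolding SFS_def specht_character_def specht_module_def specht_rep_def
    by (rule signed_FS_indicator_left_ideal[OF finite_G cc])
      (use sandwich_scalar_pos sign_mult sign_inv in auto)
  also have "\<dots> = of_int signed_square_sum / of_int ?n"
    by (simp add: signed_square_sum_def young_symmetrizer_eq[OF \<mu>])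
  finally have SFS: "SFS d \<mu> = of_int signed_square_sum / of_int ?n" .
  show ?thesis
  proof (cases "conj_partition \<mu> = \<mu>")
    case False
    then obtain m where "card {x \<in> {1..d}. ?rw x < m} \<noteq> card {x \<in> {1..d}. ?cl x < m}"
      using conj_partition_eqI[OF \<mu>] by blast
    then have "signed_square_sum = 0"
      using T.odd_conjugate_in_same_subgroup
      by (intro signed_square_sum_zero) (auto simp only: sym_group_carrier row_group_eq[OF \<mu>] column_group_eq[OF \<mu>])
    then show ?thesis using False SFS by simp
  next
    case True
    have swap: "prod.swap c \<in> young_diagram \<mu> \<longleftrightarrow> c \<in> young_diagram \<mu>" for c
      using young_diagram_conj[OF \<mu>] True by (metis pair_in_swap_image swap_simp surj_pair)
    \<comment> \<open>The reflection of the tableau in its diagonal, acting on entries.\<close>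
    define t where "t x = (if x \<in> {1..d} then row_tableau \<mu> (prod.swap (cell \<mu> x)) else x)" for x
    have t_in: "t x \<in> {1..d}" and cell_t: "cell \<mu> (t x) = prod.swap (cell \<mu> x)" if "x \<in> {1..d}" for x
      using that cell_in[OF \<mu> that] swap row_tableau_in[OF \<mu>] cell_row_tableau[OF \<mu>] by (auto simp: t_def)
    have tt: "t (t x) = x" for x
    proof (cases "x \<in> {1..d}")
      case True
      then have "t (t x) = row_tableau \<mu> (prod.swap (cell \<mu> (t x)))" using t_in by (simp add: t_def)
      then show ?thesis using True by (simp add: cell_t row_tableau_cell[OF \<mu>])
    next
      case False
      then have "t x = x" unfolding t_def by (rule if_not_P)
      then show ?thesis by simp
    qed
    have t_perm: "t permutes {1..d}"
    proof (rule inj_imp_permutes)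
      show "inj_on t {1..d}" by (metis inj_onI tt)
    qed (use t_in in \<open>auto simp: t_def\<close>)
    have rw_t: "?rw (t x) = ?cl x" and cl_t: "?cl (t x) = ?rw x" if "x \<in> {1..d}" for x
      using cell_t[OF that] by (simp_all add: row_of_def column_of_def)
    have "signed_square_sum = sign t * ?n"
    proof (rule signed_square_sum_swap)
      show "t \<in> carrier ?G" using t_perm by (simp add: sym_group_carrier)
      show "t \<otimes>\<^bsub>?G\<^esub> t = \<one>\<^bsub>?G\<^esub>" using tt by (simp add: sym_group_mult sym_group_one fun_eq_iff)
      have conj: "t \<circ> p \<circ> t permutes {1..d}" if "p permutes {1..d}" for p
        by (intro permutes_compose t_perm that)
      have in_X: "p (t x) \<in> {1..d}" if "p permutes {1..d}" "x \<in> {1..d}" for p x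
        using that t_in permutes_in_image by metis
      show "t \<otimes>\<^bsub>?G\<^esub> p \<otimes>\<^bsub>?G\<^esub> t \<in> column_group d \<mu>" if "p \<in> row_group d \<mu>" for p
        using that conj[of p] in_X[of p] t_in
        by (simp add: row_group_eq[OF \<mu>] column_group_eq[OF \<mu>] sym_group_mult young_subgroup_def cl_t rw_t)
      show "t \<otimes>\<^bsub>?G\<^esub> p \<otimes>\<^bsub>?G\<^esub> t \<in> row_group d \<mu>" if "p \<in> column_group d \<mu>" for p
        using that conj[of p] in_X[of p] t_in
        by (simp add: row_group_eq[OF \<mu>] column_group_eq[OF \<mu>] sym_group_mult young_subgroup_def cl_t rw_t)
    qed
    moreover have "sign t = (- 1) ^ ((d - diag_length \<mu>) div 2)"
    proof -
      have fixed: "t x = x \<longleftrightarrow> fst (cell \<mu> x) = snd (cell \<mu> x)" if "x \<in> {1..d}" for x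
      proof
        assume "t x = x"
        then show "fst (cell \<mu> x) = snd (cell \<mu> x)" using cell_t[OF that] by (metis fst_swap)
      next
        assume "fst (cell \<mu> x) = snd (cell \<mu> x)"
        then have "prod.swap (cell \<mu> x) = cell \<mu> x" by (simp add: prod_eq_iff)
        then show "t x = x" using that row_tableau_cell[OF \<mu>] by (simp add: t_def)
      qed
      have "card {x \<in> {1..d}. t x = x} = card {c \<in> young_diagram \<mu>. fst c = snd c}"
        using card_cell_restrict[OF \<mu>, of "\<lambda>c. fst c = snd c"] by (simp add: fixed cong: conj_cong)
      also have "{c \<in> young_diagram \<mu>. fst c = snd c} = (\<lambda>i. (i, i)) ` {i. i < length \<mu> \<and> \<mu> ! i \<ge> Suc i}"
        by (auto simp: young_diagram_def)
      also have "card \<dots> = diag_length \<mu>"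
        by (simp add: diag_length_def card_image inj_on_def)
      finally have "card {x \<in> {1..d}. t x = x} = diag_length \<mu>" .
      moreover have "{x \<in> {1..d}. t x \<noteq> x} = {1..d} - {x \<in> {1..d}. t x = x}" by blast
      moreover have "card ({1..d} - {x \<in> {1..d}. t x = x}) = card {1..d} - card {x \<in> {1..d}. t x = x}"
        by (rule card_Diff_subset) auto
      ultimately have "card {x \<in> {1..d}. t x \<noteq> x} = d - diag_length \<mu>" by simp
      then show ?thesis using sign_involution[OF _ t_perm] tt by (simp add: fun_eq_iff)
    qed
    ultimately show ?thesis using True SFS sandwich_scalar_pos by simp
  qed
qed

end
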